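(* For every $n\in\mathbb{N}$ and every proper cone $\mathsf{C}$ in a finite-dimensional real vector space, the pairs $(\mathsf{L}_n,\mathsf{C})$ and $(\mathsf{C},\mathsf{L}_n)$ are resilient. In particular, the Lorentz cone $\mathsf{L}_n$ is resilient for every $n\in\mathbb{N}$.
   Context: All vector spaces are finite-dimensional and real; $\mathbb{N}=\{1,2,\dots\}$. A convex cone $\mathsf{C}\subset V$ is proper if it is closed, $\mathsf{C}-\mathsf{C}=V$ and $\mathsf{C}\cap(-\mathsf{C})=\{0\}$. Its dual cone is $\mathsf{C}^*=\{\phi\in V^*: \phi(x)\ge 0\ \forall x\in\mathsf{C}\}$. For proper cones $\mathsf{C}_1\subset V_1$, $\mathsf{C}_2\subset V_2$ let $\mathsf{C}_1\otimes_{\min}\mathsf{C}_2=\mathrm{conv}\{x\otimes y: x\in\mathsf{C}_1,y\in\mathsf{C}_2\}\subset V_1\otimes V_2$ and $\mathsf{C}_1\otimes_{\max}\mathsf{C}_2=(\mathsf{C}_1^*\otimes_{\min}\mathsf{C}_2^* )^*\subset V_1\otimes V_2$. Tensor powers are defined by $\mathsf{C}^{\otimes_{\min}1}=\mathsf{C}^{\otimes_{\max}1}=\mathsf{C}$, $\mathsf{C}^{\otimes_{\min}(k+1)}=\mathsf{C}\otimes_{\min}\mathsf{C}^{\otimes_{\min}k}$ and $\mathsf{C}^{\otimes_{\max}(k+1)}=\mathsf{C}\otimes_{\max}\mathsf{C}^{\otimes_{\max}k}$. A linear map $P:V_1\to V_2$ is $(\mathsf{C}_1,\mathsf{C}_2)$-entanglement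 breaking if $P=\sum_{i=1}^k x_i\phi_i$ (i.e. $P(v)=\sum_i\phi_i(v)x_i$) is a finite sum with $x_i\in\mathsf{C}_2$, $\phi_i\in\mathsf{C}_1^*$. It is $(\mathsf{C}_1,\mathsf{C}_2)$-entanglement annihilating if $P^{\otimes k}(\mathsf{C}_1^{\otimes_{\max}k})\subseteq\mathsf{C}_2^{\otimes_{\min}k}$ for every $k\in\mathbb{N}$. The pair $(\mathsf{C}_1,\mathsf{C}_2)$ is resilient if every $(\mathsf{C}_1,\mathsf{C}_2)$-entanglement annihilating map is $(\mathsf{C}_1,\mathsf{C}_2)$-entanglement breaking; $\mathsf{C}$ is resilient if $(\mathsf{C},\mathsf{C})$ is resilient. The Lorentz cone is $\mathsf{L}_n=\{(t,x)\in\mathbb{R}\oplus\mathbb{R}^n: \|x\|_2\le t\}\subset\mathbb{R}^{n+1}$, with $\|\cdot\|_2$ the Euclidean norm. *)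

theory Defs
  imports "HOL-Analysis.Analysis" "HOL-Library.Function_Algebras"
begin

section \<open>Real-valued functions as a vector space\<close>

text \<open>Pointwise structure; the additive part comes from \<^theory>\<open>HOL-Library.Function_Algebras\<close>.\<close>

instantiation "fun" :: (type, real_vector) real_vector
begin

definition scaleR_fun :: "real \<Rightarrow> ('a \<Rightarrow> 'b) \<Rightarrow> 'a \<Rightarrow> 'b" where
  "scaleR_fun r f = (\<lambda>x. r *\<^sub>R f x)"

instance
  by standard (simp_all add: scaleR_fun_def fun_eq_iff scaleR_add_left scaleR_add_right)

end

lemma scaleR_fun_apply [simp]: "(r *\<^sub>R f) x = r *\<^sub>R f x"
  by (simp add: scaleR_fun_def)

section \<open>Cones\<close>

definition proper_cone :: "'a::real_normed_vector set \<Rightarrow> bool" where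
  "proper_cone C \<longleftrightarrow> convex_cone C \<and> closed C
     \<and> {x - y | x y. x \<in> C \<and> y \<in> C} = UNIV \<and> C \<inter> uminus ` C = {0}"

definition dual_cone :: "'a::real_vector set \<Rightarrow> ('a \<Rightarrow> real) set" where
  "dual_cone C = {\<phi>. linear \<phi> \<and> (\<forall>x\<in>C. 0 \<le> \<phi> x)}"

definition lorentz_cone :: "(real \<times> (real ^ 'n::finite)) set" where
  "lorentz_cone = {(t, x). norm x \<le> t}"

section \<open>Tensor powers of a vector space\<close>

text \<open>
  For a space \<open>V\<close> (the type \<open>'a\<close>), a tensor in the \<open>k\<close>-th power of \<open>V\<close> is represented by the
  multilinear form that it induces on \<open>k\<close>-tuples of linear functionals: \<open>x\<^sub>1 \<otimes> \<dots> \<otimes> x\<^sub>k\<close> is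
  \<open>[\<phi>\<^sub>1, \<dots>, \<phi>\<^sub>k] \<mapsto> \<phi>\<^sub>1 x\<^sub>1 * \<dots> * \<phi>\<^sub>k x\<^sub>k\<close>. This representation is faithful because linear functionals
  separate points. It puts tensors of all orders in one type. The value is \<open>0\<close> on lists of another
  length and on lists with a nonlinear entry.
\<close>

type_synonym 'a tensor = "('a \<Rightarrow> real) list \<Rightarrow> real"

definition scalar_one :: "'a tensor" where
  "scalar_one \<phi>s = (if \<phi>s = [] then 1 else 0)"

text \<open>\<open>tensor_cons x T\<close> is \<open>x \<otimes> T\<close>.\<close>

definition tensor_cons :: "'a::real_vector \<Rightarrow> 'a tensor \<Rightarrow> 'a tensor" where
  "tensor_cons x T \<phi>s =
     (case \<phi>s of [] \<Rightarrow> 0 | \<phi> # \<phi>s' \<Rightarrow> if linear \<phi> then \<phi> x * T \<phi>s' else 0)"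

text \<open>The identification of \<open>V\<close> with its first tensor power.\<close>

definition tensor_of :: "'a::real_vector \<Rightarrow> 'a tensor" where
  "tensor_of x = tensor_cons x scalar_one"

text \<open>The functional \<open>\<phi> \<otimes> \<psi>\<close> on \<open>V \<otimes> W\<close>, with \<open>W\<close> a tensor power of \<open>V\<close>; it maps \<open>x \<otimes> T\<close> to
  \<open>\<phi> x * \<psi> T\<close>, see \<open>functional_tensor_cons\<close> below.\<close>

definition functional_tensor :: "('a \<Rightarrow> real) \<Rightarrow> ('a tensor \<Rightarrow> real) \<Rightarrow> 'a tensor \<Rightarrow> real" where
  "functional_tensor \<phi> \<psi> T = \<psi> (\<lambda>\<phi>s. T (\<phi> # \<phi>s))"

text \<open>The tensor powers are indexed from \<open>1\<close>; here and below, index \<open>0\<close> is left unspecified.\<close>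

fun tensor_space :: "nat \<Rightarrow> 'a::real_vector tensor set" where
  "tensor_space (Suc 0) = range tensor_of"
| "tensor_space (Suc (Suc k)) = span {tensor_cons x T | x T. T \<in> tensor_space (Suc k)}"

text \<open>The tensor power of \<open>P\<close>, as the pullback along \<open>\<psi> \<mapsto> \<psi> \<circ> P\<close>. It is the linear map that sends
  \<open>x\<^sub>1 \<otimes> \<dots> \<otimes> x\<^sub>k\<close> to \<open>P x\<^sub>1 \<otimes> \<dots> \<otimes> P x\<^sub>k\<close>, see \<open>linear_tensor_map\<close>, \<open>tensor_map_of\<close> and
  \<open>tensor_map_cons\<close> below.\<close>

definition tensor_map :: "('a::real_vector \<Rightarrow> 'b::real_vector) \<Rightarrow> 'a tensor \<Rightarrow> 'b tensor" where
  "tensor_map P T \<psi>s = (if \<forall>\<psi>\<in>set \<psi>s. linear \<psi> then T (map (\<lambda>\<psi>. \<psi> \<circ> P) \<psi>s) else 0)"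

lemma linear_tensor_cons_left: "linear (\<lambda>x. tensor_cons x T)"
  by (rule linearI)
     (auto simp: fun_eq_iff tensor_cons_def linear_add linear_scale algebra_simps split: list.split)

lemma linear_tensor_cons_right: "linear (tensor_cons x)"
  by (rule linearI) (auto simp: fun_eq_iff tensor_cons_def algebra_simps split: list.split)

lemma functional_tensor_cons:
  assumes "linear \<phi>" "linear \<psi>"
  shows "functional_tensor \<phi> \<psi> (tensor_cons x T) = \<phi> x * \<psi> T"
proof -
  have "(\<lambda>\<phi>s. tensor_cons x T (\<phi> # \<phi>s)) = \<phi> x *\<^sub>R T"
    using assms(1) by (simp add: fun_eq_iff tensor_cons_def)
  then show ?thesis
    using assms(2) by (simp add: functional_tensor_def linear_scale)
qed

lemma linear_functional_tensor:
  assumes "linear \<psi>"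
  shows "linear (functional_tensor \<phi> \<psi>)"
proof (rule linearI)
  fix S T :: "'a tensor" and r :: real
  have "(\<lambda>\<phi>s. (S + T) (\<phi> # \<phi>s)) = (\<lambda>\<phi>s. S (\<phi> # \<phi>s)) + (\<lambda>\<phi>s. T (\<phi> # \<phi>s))"
    by (simp add: fun_eq_iff)
  then show "functional_tensor \<phi> \<psi> (S + T) = functional_tensor \<phi> \<psi> S + functional_tensor \<phi> \<psi> T"
    using assms by (simp add: functional_tensor_def linear_add)
  have "(\<lambda>\<phi>s. (r *\<^sub>R T) (\<phi> # \<phi>s)) = r *\<^sub>R (\<lambda>\<phi>s. T (\<phi> # \<phi>s))"
    by (simp add: fun_eq_iff)
  then show "functional_tensor \<phi> \<psi> (r *\<^sub>R T) = r *\<^sub>R functional_tensor \<phi> \<psi> T"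
    using assms by (simp add: functional_tensor_def linear_scale)
qed

lemma linear_tensor_map: "linear (tensor_map P)"
  by (rule linearI) (auto simp: fun_eq_iff tensor_map_def)

lemma tensor_map_cons:
  assumes "linear P"
  shows "tensor_map P (tensor_cons x T) = tensor_cons (P x) (tensor_map P T)"
  using assms by (auto simp: fun_eq_iff tensor_cons_def tensor_map_def linear_compose split: list.split)

lemma tensor_map_of:
  assumes "linear P"
  shows "tensor_map P (tensor_of x) = tensor_of (P x)"
proof -
  have "tensor_map P scalar_one = scalar_one"
    by (auto simp: fun_eq_iff tensor_map_def scalar_one_def)
  then show ?thesis
    using assms by (simp add: tensor_of_def tensor_map_cons)
qed

section \<open>Minimal and maximal tensor powers of cones\<close>

definition min_tensor :: "'a::real_vector set \<Rightarrow> 'a tensor set \<Rightarrow> 'a tensor set" where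
  "min_tensor C D = convex hull {tensor_cons x T | x T. x \<in> C \<and> T \<in> D}"

text \<open>
  \<open>max_tensor k C D\<close> is the maximal tensor product of \<open>C\<close> and a cone \<open>D\<close> in the \<open>k\<close>-th tensor power
  of \<open>V\<close>; the result lies in the power \<open>k + 1\<close>. In \<open>dual_cone D\<close> the functionals are defined on the
  whole type \<open>'a tensor\<close> rather than on \<open>tensor_space k\<close> only. Every linear functional on
  \<open>tensor_space k\<close> is the restriction of such a functional, and on \<open>tensor_space (Suc k)\<close> the
  functional \<open>\<phi> \<otimes> \<psi>\<close> depends only on the restriction of \<open>\<psi>\<close> to \<open>tensor_space k\<close>.
\<close>

definition max_tensor :: "nat \<Rightarrow> 'a::real_vector set \<Rightarrow> 'a tensor set \<Rightarrow> 'a tensor set" where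
  "max_tensor k C D = {T \<in> tensor_space (Suc k).
     \<forall>\<omega> \<in> convex hull {functional_tensor \<phi> \<psi> | \<phi> \<psi>. \<phi> \<in> dual_cone C \<and> \<psi> \<in> dual_cone D}. 0 \<le> \<omega> T}"

fun min_power :: "'a::real_vector set \<Rightarrow> nat \<Rightarrow> 'a tensor set" where
  "min_power C (Suc 0) = tensor_of ` C"
| "min_power C (Suc (Suc k)) = min_tensor C (min_power C (Suc k))"

fun max_power :: "'a::real_vector set \<Rightarrow> nat \<Rightarrow> 'a tensor set" where
  "max_power C (Suc 0) = tensor_of ` C"
| "max_power C (Suc (Suc k)) = max_tensor (Suc k) C (max_power C (Suc k))"

section \<open>Resilience\<close>

definition entanglement_breaking ::
  "'a::real_vector set \<Rightarrow> 'b::real_vector set \<Rightarrow> ('a \<Rightarrow> 'b) \<Rightarrow> bool" where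
  "entanglement_breaking C\<^sub>1 C\<^sub>2 P \<longleftrightarrow>
     (\<exists>(k::nat) x \<phi>. (\<forall>i\<in>{1..k}. x i \<in> C\<^sub>2 \<and> \<phi> i \<in> dual_cone C\<^sub>1)
        \<and> P = (\<lambda>v. \<Sum>i=1..k. \<phi> i v *\<^sub>R x i))"

definition entanglement_annihilating ::
  "'a::real_vector set \<Rightarrow> 'b::real_vector set \<Rightarrow> ('a \<Rightarrow> 'b) \<Rightarrow> bool" where
  "entanglement_annihilating C\<^sub>1 C\<^sub>2 P \<longleftrightarrow>
     linear P \<and> (\<forall>k\<ge>1. tensor_map P ` max_power C\<^sub>1 k \<subseteq> min_power C\<^sub>2 k)"

definition resilient :: "'a::real_vector set \<Rightarrow> 'b::real_vector set \<Rightarrow> bool" where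
  "resilient C\<^sub>1 C\<^sub>2 \<longleftrightarrow>
     (\<forall>P. entanglement_annihilating C\<^sub>1 C\<^sub>2 P \<longrightarrow> entanglement_breaking C\<^sub>1 C\<^sub>2 P)"

end

(*
  If P is annihilating but not entanglement breaking, it is separated from the closed cone of
  entanglement breaking maps by a positive map Q. Composing P with Q on the appropriate side gives
  an annihilating map R of the Lorentz cone whose trace is negative. Write R = (r, *; *, M) in
  blocks, so that tr M < -r <= 0.

  For a tensor A on R^n with k legs, e_0^k + A/b is in the maximal power, and e_0^k - A/b is
  nonnegative on the minimal power, as soon as b bounds the injective norm of A. Applying the
  annihilating property to this pair, and to the pair for -A, gives <A, M^k A> <= b^2 r^k. Average
  over all A with entries 1 and -1: the left side becomes (tr M)^k. A random sign tensor has
  injective norm at most polynomial in k, up to a factor rho^k with rho > 1 arbitrarily close to 1: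
  replace the unit ball by a polytope of radius rho and apply a union bound with Gaussian tails to
  the k-tuples of its vertices. Hence (tr M)^k <= poly(k) rho^(2k) r^k for all even k,
  which forces |tr M| <= r.
*)

theory Submission
  imports Defs
begin

section \<open>Positivity on tensor powers\<close>

text \<open>The pairing of \<open>P\<close> with the separating \<open>Q\<close> is the trace of
  \<open>R\<close>, so everything rests on traces being nonnegative. No single power decides this;
  the argument compares exponential growth rates in \<open>k\<close>. Sign tensors suit it because
  they separate two norms: their entries have mean square 1, so that averaging retains the full
  diagonal (tr M)^k, whereas their injective norm grows at a rate arbitrarily close to 1, far below
  the Euclidean norm n^(k/2). The bound \<open>b\<close> may vary with the tensor, since only the
  mean of b^2 enters. The Lorentz cone is what brings in the injective norm: its vectors are t(1,u)
  with u in the Euclidean ball, and it is its own dual, so positivity of the tensor and of the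
  functional are the same estimate. The polytope is fixed before \<open>k\<close>, from the strict
  gap r < |tr M|; its number of vertices then costs only a polynomial in \<open>k\<close>. Even
  \<open>k\<close> turns the negative trace into a large positive power.\<close>

definition elementary_tensor :: "'a::real_vector list \<Rightarrow> 'a tensor" where
  "elementary_tensor xs = foldr tensor_cons xs scalar_one"

lemma elementary_tensor_Nil [simp]: "elementary_tensor [] = scalar_one"
  and elementary_tensor_Cons [simp]:
    "elementary_tensor (x # xs) = tensor_cons x (elementary_tensor xs)"
  by (simp_all add: elementary_tensor_def)

lemma elementary_tensor_apply:
  assumes "length \<phi>s = length xs" "\<And>\<phi>. \<phi> \<in> set \<phi>s \<Longrightarrow> linear \<phi>"
  shows "elementary_tensor xs \<phi>s = prod_list (map2 (\<lambda>\<phi> x. \<phi> x) \<phi>s xs)"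
  using assms
  by (induction \<phi>s xs rule: list_induct2) (auto simp: tensor_cons_def scalar_one_def)

lemma tensor_map_elementary:
  assumes "linear P"
  shows "tensor_map P (elementary_tensor xs) = elementary_tensor (map P xs)"
proof (induction xs)
  case Nil
  show ?case by (auto simp: fun_eq_iff tensor_map_def scalar_one_def)
qed (simp add: tensor_map_cons assms)

lemma tensor_map_compose:
  fixes P :: "'a::real_vector \<Rightarrow> 'b::real_vector" and Q :: "'b \<Rightarrow> 'c::real_vector"
  assumes "linear P" "linear Q"
  shows "tensor_map (Q \<circ> P) T = tensor_map Q (tensor_map P T)"
proof
  fix \<psi>s :: "('c \<Rightarrow> real) list"
  have "linear (\<psi> \<circ> Q)" if "linear \<psi>" for \<psi> :: "'c \<Rightarrow> real"
    using assms(2) that by (rule linear_compose)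
  then show "tensor_map (Q \<circ> P) T \<psi>s = tensor_map Q (tensor_map P T) \<psi>s"
    by (auto simp: tensor_map_def comp_def)
qed

lemma subspace_tensor_space: "subspace (tensor_space (Suc k))"
proof (cases k)
  case 0
  have "linear (tensor_of :: 'a \<Rightarrow> 'a tensor)"
    unfolding tensor_of_def by (rule linear_tensor_cons_left)
  then show ?thesis using 0 by (simp add: linear_subspace_image)
qed simp

lemma elementary_tensor_in_tensor_space:
  "xs \<noteq> [] \<Longrightarrow> elementary_tensor xs \<in> tensor_space (length xs)"
proof (induction xs rule: list_nonempty_induct)
  case (single x)
  show ?case by (auto simp: tensor_of_def)
next
  case (cons x xs)
  then obtain k where "length xs = Suc k" by (cases xs) auto
  with cons show ?case by (auto intro: span_base)
qed

text \<open>On a generator, inserting \<open>\<phi>\<close> in the first slot leaves the multiple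
  \<open>\<phi> x\<close> of the remaining tensor. This is the step by which inductions over maximal
  powers remove one leg.\<close>

lemma tensor_space_contract:
  assumes "T \<in> tensor_space (Suc (Suc k))" "linear \<phi>"
  shows "(\<lambda>\<phi>s. T (\<phi> # \<phi>s)) \<in> tensor_space (Suc k)"
proof -
  have lin: "linear (\<lambda>T \<phi>s. T (\<phi> # \<phi>s) :: real)"
    by (rule linearI) (auto simp: fun_eq_iff)
  have "subspace {T. (\<lambda>\<phi>s. T (\<phi> # \<phi>s)) \<in> tensor_space (Suc k)}"
    using linear_subspace_vimage [OF lin subspace_tensor_space] by (simp add: vimage_def)
  moreover have "{tensor_cons x S | x S. S \<in> tensor_space (Suc k)}
      \<subseteq> {T. (\<lambda>\<phi>s. T (\<phi> # \<phi>s)) \<in> tensor_space (Suc k)}"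
  proof clarify
    fix x and S :: "'a tensor" assume S: "S \<in> tensor_space (Suc k)"
    have "(\<lambda>\<phi>s. tensor_cons x S (\<phi> # \<phi>s)) = \<phi> x *\<^sub>R S"
      using assms(2) by (simp add: fun_eq_iff tensor_cons_def)
    then show "(\<lambda>\<phi>s. tensor_cons x S (\<phi> # \<phi>s)) \<in> tensor_space (Suc k)"
      using S subspace_scale [OF subspace_tensor_space] by metis
  qed
  ultimately have "span {tensor_cons x S | x S. S \<in> tensor_space (Suc k)}
      \<subseteq> {T. (\<lambda>\<phi>s. T (\<phi> # \<phi>s)) \<in> tensor_space (Suc k)}"
    by (intro span_minimal)
  with assms(1) show ?thesis by auto
qed

lemma tensor_map_tensor_space:
  assumes "linear P" "T \<in> tensor_space (Suc k)"
  shows "tensor_map P T \<in> tensor_space (Suc k)"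
  using assms(2)
proof (induction k arbitrary: T)
  case 0
  then show ?case by (auto simp: tensor_map_of assms(1))
next
  case (Suc k)
  have "subspace {T. tensor_map P T \<in> tensor_space (Suc (Suc k))}"
    using linear_subspace_vimage [OF linear_tensor_map subspace_tensor_space]
    by (simp only: vimage_def)
  moreover have "{tensor_cons x S | x S. S \<in> tensor_space (Suc k)}
      \<subseteq> {T. tensor_map P T \<in> tensor_space (Suc (Suc k))}"
    using Suc.IH by (fastforce simp: tensor_map_cons assms(1) intro: span_base)
  ultimately have "span {tensor_cons x S | x S. S \<in> tensor_space (Suc k)}
      \<subseteq> {T. tensor_map P T \<in> tensor_space (Suc (Suc k))}"
    by (intro span_minimal)
  with Suc.prems show ?case by auto
qed

lemma max_tensorI:
  assumes "T \<in> tensor_space (Suc k)"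
    and "\<And>\<phi> \<psi>. \<phi> \<in> dual_cone C \<Longrightarrow> \<psi> \<in> dual_cone D \<Longrightarrow> 0 \<le> functional_tensor \<phi> \<psi> T"
  shows "T \<in> max_tensor k C D"
proof -
  have "convex {\<omega> :: 'a tensor \<Rightarrow> real. 0 \<le> \<omega> T}"
    by (auto simp: convex_def)
  then have "convex hull {functional_tensor \<phi> \<psi> | \<phi> \<psi>. \<phi> \<in> dual_cone C \<and> \<psi> \<in> dual_cone D}
      \<subseteq> {\<omega>. 0 \<le> \<omega> T}"
    using assms(2) by (intro hull_minimal) auto
  then show ?thesis using assms(1) by (auto simp: max_tensor_def)
qed

lemma max_tensorD:
  assumes "T \<in> max_tensor k C D" "\<phi> \<in> dual_cone C" "\<psi> \<in> dual_cone D"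
  shows "0 \<le> functional_tensor \<phi> \<psi> T"
  using assms unfolding max_tensor_def by (auto intro: hull_inc)

text \<open>Contracting the first leg with a dual functional leaves, by induction, a tensor of the
  smaller maximal power, on which every \<open>\<psi>\<close> of its dual cone is nonnegative by
  definition. The bidual hypothesis serves the case of one leg, where the power is \<open>C\<close>
  itself.\<close>

lemma max_powerI:
  assumes bidual: "\<And>x. (\<And>\<phi>. \<phi> \<in> dual_cone C \<Longrightarrow> 0 \<le> \<phi> x) \<Longrightarrow> x \<in> C"
    and "T \<in> tensor_space (Suc k)"
    and "\<And>\<phi>s. length \<phi>s = Suc k \<Longrightarrow> set \<phi>s \<subseteq> dual_cone C \<Longrightarrow> 0 \<le> T \<phi>s"
  shows "T \<in> max_power C (Suc k)"
  using assms(2,3)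
proof (induction k arbitrary: T)
  case 0
  then obtain x where T: "T = tensor_of x" by auto
  have "0 \<le> \<phi> x" if "\<phi> \<in> dual_cone C" for \<phi>
    using 0(2) [of "[\<phi>]"] that
    by (auto simp: T tensor_of_def tensor_cons_def scalar_one_def dual_cone_def)
  with bidual T show ?case by auto
next
  case (Suc k)
  have "0 \<le> functional_tensor \<phi> \<psi> T"
    if \<phi>: "\<phi> \<in> dual_cone C" and \<psi>: "\<psi> \<in> dual_cone (max_power C (Suc k))" for \<phi> \<psi>
  proof -
    have "linear \<phi>" using \<phi> by (simp add: dual_cone_def)
    with Suc.prems(1) have "(\<lambda>\<phi>s. T (\<phi> # \<phi>s)) \<in> tensor_space (Suc k)"
      by (rule tensor_space_contract)
    then have "(\<lambda>\<phi>s. T (\<phi> # \<phi>s)) \<in> max_power C (Suc k)"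
      by (rule Suc.IH) (use Suc.prems(2) \<phi> in auto)
    with \<psi> show ?thesis by (simp add: functional_tensor_def dual_cone_def)
  qed
  with Suc.prems(1) show ?case by (auto intro: max_tensorI)
qed

text \<open>Dual functionals pull back: \<open>\<phi> \<circ> P\<close> is positive on
  \<open>C\<close>, and by induction \<open>\<psi> \<circ> tensor_map P\<close> is positive on the
  smaller maximal power of \<open>C\<close>.\<close>

lemma tensor_map_max_power:
  assumes P: "linear P" "P ` C \<subseteq> D" and "T \<in> max_power C (Suc k)"
  shows "tensor_map P T \<in> max_power D (Suc k)"
  using assms(3)
proof (induction k arbitrary: T)
  case 0
  then show ?case using P by (auto simp: tensor_map_of)
next
  case (Suc k)
  from Suc.prems have "T \<in> tensor_space (Suc (Suc k))"
    by (simp add: max_tensor_def)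
  then have "tensor_map P T \<in> tensor_space (Suc (Suc k))"
    by (rule tensor_map_tensor_space [OF P(1)])
  moreover have "0 \<le> functional_tensor \<phi> \<psi> (tensor_map P T)"
    if \<phi>: "\<phi> \<in> dual_cone D" and \<psi>: "\<psi> \<in> dual_cone (max_power D (Suc k))" for \<phi> \<psi>
  proof -
    have "linear \<phi>" using \<phi> by (simp add: dual_cone_def)
    then have "(\<lambda>\<phi>s. tensor_map P T (\<phi> # \<phi>s)) = tensor_map P (\<lambda>\<phi>s. T ((\<phi> \<circ> P) # \<phi>s))"
      by (simp add: fun_eq_iff tensor_map_def)
    then have "functional_tensor \<phi> \<psi> (tensor_map P T)
        = functional_tensor (\<phi> \<circ> P) (\<psi> \<circ> tensor_map P) T"
      by (simp add: functional_tensor_def)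
    moreover have "\<phi> \<circ> P \<in> dual_cone C"
      using \<phi> P by (auto simp: dual_cone_def linear_compose)
    moreover have "\<psi> \<circ> tensor_map P \<in> dual_cone (max_power C (Suc k))"
      using \<psi> Suc.IH by (auto simp: dual_cone_def linear_compose [OF linear_tensor_map])
    ultimately show ?thesis
      using Suc.prems by (auto dest: max_tensorD)
  qed
  ultimately show ?case by (auto intro: max_tensorI)
qed

lemma tensor_map_min_power:
  assumes P: "linear P" "P ` C \<subseteq> D" and "T \<in> min_power C (Suc k)"
  shows "tensor_map P T \<in> min_power D (Suc k)"
  using assms(3)
proof (induction k arbitrary: T)
  case 0
  then show ?case using P by (auto simp: tensor_map_of)
next
  case (Suc k)
  let ?G = "\<lambda>C. {tensor_cons x T | x T. x \<in> C \<and> T \<in> min_power C (Suc k)}"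
  have "tensor_map P ` ?G C \<subseteq> {tensor_cons x T | x T. x \<in> D \<and> T \<in> min_power D (Suc k)}"
    using P Suc.IH by (fastforce simp: tensor_map_cons)
  then have "tensor_map P ` (convex hull ?G C)
      \<subseteq> convex hull {tensor_cons x T | x T. x \<in> D \<and> T \<in> min_power D (Suc k)}"
    by (simp add: convex_hull_linear_image [OF linear_tensor_map] hull_mono)
  with Suc.prems show ?case by (auto simp: min_tensor_def)
qed

text \<open>The induction varies \<open>\<psi>\<close>: fixing the first factor \<open>x\<close>
  replaces it by the linear functional \<open>\<psi> \<circ> tensor_cons x\<close> on tensors with
  one leg less.\<close>

lemma min_power_nonneg:
  fixes \<psi> :: "'a::real_vector tensor \<Rightarrow> real"
  assumes "T \<in> min_power C (Suc k)" "linear \<psi>"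
    and "\<And>xs. length xs = Suc k \<Longrightarrow> set xs \<subseteq> C \<Longrightarrow> 0 \<le> \<psi> (elementary_tensor xs)"
  shows "0 \<le> \<psi> T"
  using assms
proof (induction k arbitrary: T \<psi>)
  case 0
  then obtain x where "T = tensor_of x" "x \<in> C" by auto
  with 0(3) [of "[x]"] show ?case by (simp add: tensor_of_def)
next
  case (Suc k)
  have "convex {T. 0 \<le> \<psi> T}"
    using Suc.prems(2) by (auto simp: convex_def linear_add linear_scale)
  moreover have "0 \<le> \<psi> (tensor_cons x S)" if "x \<in> C" "S \<in> min_power C (Suc k)" for x S
  proof -
    have "0 \<le> (\<psi> \<circ> tensor_cons x) S"
      using that(2)
    proof (rule Suc.IH)
      show "linear (\<psi> \<circ> tensor_cons x)"
        by (rule linear_compose [OF linear_tensor_cons_right Suc.prems(2)])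
      show "0 \<le> (\<psi> \<circ> tensor_cons x) (elementary_tensor xs)"
        if "length xs = Suc k" "set xs \<subseteq> C" for xs
        using Suc.prems(3) [of "x # xs"] that \<open>x \<in> C\<close> by simp
    qed
    then show ?thesis by simp
  qed
  ultimately have "convex hull {tensor_cons x T | x T. x \<in> C \<and> T \<in> min_power C (Suc k)}
      \<subseteq> {T. 0 \<le> \<psi> T}"
    by (intro hull_minimal) auto
  with Suc.prems(1) show ?case by (auto simp: min_tensor_def)
qed

section \<open>Random sign tensors\<close>

definition multi_indices :: "nat \<Rightarrow> 'n list set" where
  "multi_indices k = {is. length is = k}"

lemma finite_multi_indices [simp]: "finite (multi_indices k :: 'n::finite list set)"
  using finite_lists_length_eq [of "UNIV :: 'n set" k] by (simp add: multi_indices_def)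

lemma multi_indices_0 [simp]: "multi_indices 0 = {[]}"
  by (auto simp: multi_indices_def)

lemma sum_multi_indices_Suc:
  "(\<Sum>is\<in>multi_indices (Suc k). f is)
    = (\<Sum>i\<in>(UNIV :: 'n::finite set). \<Sum>is\<in>multi_indices k. f (i # is))"
proof -
  have "multi_indices (Suc k) = (\<lambda>(i, is). i # is) ` (UNIV \<times> (multi_indices k :: 'n list set))"
    by (force simp: multi_indices_def length_Suc_conv image_iff)
  moreover have "inj_on (\<lambda>(i, is). i # is) (UNIV \<times> (multi_indices k :: 'n list set))"
    by (auto simp: inj_on_def)
  ultimately show ?thesis
    by (simp add: sum.reindex sum.cartesian_product case_prod_unfold)
qed

definition monomial :: "(real ^ 'n) list \<Rightarrow> 'n list \<Rightarrow> real" where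
  "monomial xs is = prod_list (map2 ($) xs is)"

text \<open>The multilinear form with coefficient array \<open>a\<close>; the supremum of its
  absolute value over unit vectors is the injective norm of \<open>a\<close>.\<close>

definition multiform :: "('n::finite list \<Rightarrow> real) \<Rightarrow> (real ^ 'n) list \<Rightarrow> real" where
  "multiform a xs = (\<Sum>is\<in>multi_indices (length xs). a is * monomial xs is)"

lemma monomial_Nil [simp]: "monomial [] is = 1"
  and monomial_Cons [simp]: "monomial (x # xs) (i # is) = x $ i * monomial xs is"
  by (simp_all add: monomial_def)

lemma monomial_scale:
  "length ts = length xs \<Longrightarrow> length is = length xs \<Longrightarrow>
    monomial (map2 (*\<^sub>R) ts xs) is = prod_list ts * monomial xs is"
proof (induction xs arbitrary: ts "is")
  case (Cons x xs)
  then show ?case by (cases ts; cases "is") auto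
qed simp

lemma multiform_scale:
  assumes "length ts = length xs"
  shows "multiform a (map2 (*\<^sub>R) ts xs) = prod_list ts * multiform a xs"
  using assms
  by (auto simp: multiform_def sum_distrib_left monomial_scale multi_indices_def
      intro!: sum.cong)

lemma multiform_Cons:
  "multiform a (x # xs) = multiform (\<lambda>is. \<Sum>i\<in>UNIV. x $ i * a (i # is)) xs"
proof -
  have "multiform a (x # xs)
      = (\<Sum>is\<in>multi_indices (length xs). \<Sum>i\<in>UNIV. a (i # is) * (x $ i * monomial xs is))"
    unfolding multiform_def by (simp add: sum_multi_indices_Suc) (rule sum.swap)
  then show ?thesis
    by (simp only: multiform_def sum_distrib_right) (simp add: mult_ac)
qed

lemma linear_multiform_Cons: "linear (\<lambda>x. multiform a (x # xs))"
proof -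
  have "multiform a (x # xs)
      = (\<Sum>i\<in>UNIV. x $ i * (\<Sum>is\<in>multi_indices (length xs). a (i # is) * monomial xs is))" for x
    by (simp add: multiform_def sum_multi_indices_Suc sum_distrib_left mult_ac)
  then show ?thesis
    by (intro linearI) (simp_all add: distrib_right sum.distrib sum_distrib_left mult.assoc)
qed

lemma multiform_uminus [simp]: "multiform (\<lambda>is. - a is) xs = - multiform a xs"
  by (simp add: multiform_def sum_negf)

text \<open>The Euclidean norm of a product tensor is the product of the norms. For random signs
  \<open>a\<close> this is the variance of \<open>multiform a xs\<close>.\<close>

lemma sum_monomial_squared:
  "(\<Sum>is\<in>multi_indices (length xs). (monomial xs is)\<^sup>2) = (prod_list (map norm xs))\<^sup>2"
proof (induction xs)
  case (Cons x xs)
  have "(norm x)\<^sup>2 = (\<Sum>i\<in>UNIV. (x $ i)\<^sup>2)"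
    by (simp add: norm_vec_def L2_set_def sum_nonneg)
  then show ?case
    by (simp add: sum_multi_indices_Suc power_mult_distrib sum_distrib_left [symmetric] Cons
        sum_distrib_right [symmetric])
qed simp

text \<open>A linear form bounded by \<open>b\<close> on \<open>G\<close> is bounded by
  \<open>b\<close> on the hull, and the arguments are moved into the hull one at a time. The
  induction varies \<open>a\<close> because a moved argument is absorbed into the
  coefficients.\<close>

lemma multiform_bound_hull:
  assumes "\<And>gs. length gs = k \<Longrightarrow> set gs \<subseteq> G \<Longrightarrow> \<bar>multiform a gs\<bar> \<le> b"
    and "length xs = k" "set xs \<subseteq> convex hull G"
  shows "\<bar>multiform a xs\<bar> \<le> b"
  using assms
proof (induction k arbitrary: a xs)
  case (Suc k)
  then obtain x ys where xs: "xs = x # ys" and ys: "length ys = k"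
    by (auto simp: length_Suc_conv)
  have hull: "\<bar>multiform a (x # gs)\<bar> \<le> b" if gs: "length gs = k" "set gs \<subseteq> G" for gs
  proof -
    have "convex {z. \<bar>multiform a (z # gs)\<bar> \<le> b}"
      using convex_linear_vimage [OF linear_multiform_Cons convex_cball [of 0 b]]
      by (simp add: vimage_def)
    moreover have "G \<subseteq> {z. \<bar>multiform a (z # gs)\<bar> \<le> b}"
      using Suc.prems(1) gs by auto
    ultimately have "convex hull G \<subseteq> {z. \<bar>multiform a (z # gs)\<bar> \<le> b}"
      by (rule hull_minimal [rotated])
    then show ?thesis using Suc.prems(3) xs by auto
  qed
  have "\<bar>multiform (\<lambda>is. \<Sum>i\<in>UNIV. x $ i * a (i # is)) ys\<bar> \<le> b"
  proof (rule Suc.IH [OF _ ys])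
    show "set ys \<subseteq> convex hull G" using Suc.prems(3) by (simp add: xs)
  qed (use hull in \<open>simp add: multiform_Cons\<close>)
  then show ?case by (simp add: xs multiform_Cons)
next
  case 0
  from 0(1) [of "[]"] 0(2) show ?case by simp
qed

section \<open>Averages over all sign arrays, as finite sums\<close>

abbreviation sign_tensors :: "nat \<Rightarrow> ('n::finite list \<Rightarrow> real) set" where
  "sign_tensors k \<equiv> PiE (multi_indices k) (\<lambda>_. {-1, 1})"

lemma finite_sign_tensors [simp]: "finite (sign_tensors k)"
  by (simp add: finite_PiE)

text \<open>Flipping the sign at \<open>I\<close> is an involution of the sign arrays that negates
  each summand.\<close>

lemma sum_sign_tensors_offdiagonal:
  assumes "I \<in> multi_indices k" "J \<noteq> I"
  shows "(\<Sum>a\<in>sign_tensors k. a I * a J) = 0"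
proof -
  define f where "f = (\<lambda>a :: 'a list \<Rightarrow> real. a(I := - a I))"
  have "bij_betw f (sign_tensors k) (sign_tensors k)"
    by (rule bij_betw_byWitness [where f' = f])
       (use assms(1) in \<open>force simp: f_def PiE_iff extensional_def\<close>)+
  then have "(\<Sum>a\<in>sign_tensors k. a I * a J) = (\<Sum>a\<in>sign_tensors k. f a I * f a J)"
    by (rule sum.reindex_bij_betw [symmetric])
  also have "\<dots> = - (\<Sum>a\<in>sign_tensors k. a I * a J)"
    using assms(2) by (simp add: f_def sum_negf)
  finally show ?thesis by simp
qed

text \<open>Distinct entries are uncorrelated and each squares to 1, so the average of a quadratic
  form is the trace of its matrix.\<close>

lemma sum_sign_tensors_quadratic:
  fixes m :: "'n::finite list \<Rightarrow> 'n list \<Rightarrow> real"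
  shows "(\<Sum>a\<in>sign_tensors k. \<Sum>I\<in>multi_indices k. \<Sum>J\<in>multi_indices k. a I * a J * m I J)
    = real (card (sign_tensors k :: ('n list \<Rightarrow> real) set)) * (\<Sum>I\<in>multi_indices k. m I I)"
proof -
  let ?S = "sign_tensors k :: ('n list \<Rightarrow> real) set"
  have *: "(\<Sum>a\<in>?S. a I * a J) = (if J = I then real (card ?S) else 0)"
    if "I \<in> multi_indices k" for I J
  proof (cases "J = I")
    case True
    have "(\<Sum>a\<in>?S. a I * a I) = (\<Sum>a\<in>?S. 1)"
      by (rule sum.cong) (use that in \<open>auto simp: PiE_iff\<close>)
    with True show ?thesis by simp
  qed (simp add: sum_sign_tensors_offdiagonal that)
  have "(\<Sum>a\<in>?S. \<Sum>I\<in>multi_indices k. \<Sum>J\<in>multi_indices k. a I * a J * m I J)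
      = (\<Sum>I\<in>multi_indices k. \<Sum>J\<in>multi_indices k. \<Sum>a\<in>?S. a I * a J * m I J)"
    by (subst sum.swap) (intro sum.cong refl sum.swap)
  also have "\<dots> = (\<Sum>I\<in>multi_indices k. \<Sum>J\<in>multi_indices k. (\<Sum>a\<in>?S. a I * a J) * m I J)"
    by (simp add: sum_distrib_right)
  also have "\<dots> = (\<Sum>I\<in>multi_indices k. real (card ?S) * m I I)"
  proof (rule sum.cong)
    fix I :: "'n list" assume I: "I \<in> multi_indices k"
    have "(\<Sum>J\<in>multi_indices k. (\<Sum>a\<in>?S. a I * a J) * m I J)
        = (\<Sum>J\<in>multi_indices k. if J = I then real (card ?S) * m I J else 0)"
      by (rule sum.cong) (simp_all add: * I)
    then show "(\<Sum>J\<in>multi_indices k. (\<Sum>a\<in>?S. a I * a J) * m I J) = real (card ?S) * m I I"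
      using I by simp
  qed simp
  finally show ?thesis by (simp add: sum_distrib_left)
qed

text \<open>A crude form of the subgaussian bound cosh x <= exp(x^2/2) for a random sign, sufficient
  because only polynomial precision in \<open>k\<close> is required later.\<close>

lemma exp_plus_exp_minus_le:
  fixes x :: real
  assumes "\<bar>x\<bar> \<le> 1"
  shows "exp x + exp (- x) \<le> 2 * exp (x\<^sup>2)"
proof -
  have *: "exp y + exp (- y) \<le> 2 * (1 + y\<^sup>2)" if y: "0 \<le> y" "y \<le> 1" for y :: real
  proof -
    have "exp (- y) \<le> 1 / (1 + y)"
      using y exp_ge_add_one_self [of y] by (simp add: exp_minus field_simps)
    \<comment> \<open>Because (1 + y)(1 - y + y^2) = 1 + y^3.\<close>
    also have "\<dots> \<le> 1 - y + y\<^sup>2"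
      using y by (simp add: field_simps power2_eq_square)
    finally show ?thesis
      using exp_bound [OF y] by simp
  qed
  have "exp x + exp (- x) \<le> 2 * (1 + x\<^sup>2)"
    using * [of x] * [of "- x"] assms by (cases "0 \<le> x") auto
  also have "\<dots> \<le> 2 * exp (x\<^sup>2)"
    using exp_ge_add_one_self [of "x\<^sup>2"] by (intro mult_left_mono) auto
  finally show ?thesis .
qed

text \<open>Independence of the signs turns the mean of the exponential into a product of means, one
  for each entry. The resulting bound depends neither on \<open>k\<close> nor on the
  dimension.\<close>

lemma sum_exp_sign_tensors:
  fixes c :: "'n::finite list \<Rightarrow> real"
  assumes "(\<Sum>I\<in>multi_indices k. (c I)\<^sup>2) \<le> 1"
  shows "(\<Sum>a\<in>sign_tensors k. exp (\<Sum>I\<in>multi_indices k. a I * c I))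
    \<le> real (card (sign_tensors k :: ('n list \<Rightarrow> real) set)) * exp 1"
proof -
  let ?I = "multi_indices k :: 'n list set"
  have c: "\<bar>c I\<bar> \<le> 1" if "I \<in> ?I" for I
  proof -
    have "(c I)\<^sup>2 \<le> (\<Sum>I\<in>?I. (c I)\<^sup>2)"
      by (rule member_le_sum) (use that in auto)
    with assms have "(c I)\<^sup>2 \<le> 1" by linarith
    then show ?thesis by (simp add: abs_square_le_1)
  qed
  have "(\<Sum>a\<in>sign_tensors k. exp (\<Sum>I\<in>?I. a I * c I))
      = (\<Sum>a\<in>sign_tensors k. \<Prod>I\<in>?I. exp (a I * c I))"
    by (simp add: exp_sum)
  also have "\<dots> = (\<Prod>I\<in>?I. \<Sum>s\<in>{-1, 1}. exp (s * c I))"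
    by (rule prod_sum_PiE [symmetric]) auto
  also have "\<dots> \<le> (\<Prod>I\<in>?I. 2 * exp ((c I)\<^sup>2))"
    by (rule prod_mono) (use c exp_plus_exp_minus_le in \<open>auto simp: add.commute add_nonneg_nonneg\<close>)
  also have "\<dots> = 2 ^ card ?I * exp (\<Sum>I\<in>?I. (c I)\<^sup>2)"
    by (simp add: prod.distrib exp_sum)
  also have "\<dots> \<le> 2 ^ card ?I * exp 1"
    using assms by simp
  also have "2 ^ card ?I = real (card (sign_tensors k :: ('n list \<Rightarrow> real) set))"
    by (simp add: card_PiE)
  finally show ?thesis .
qed

section \<open>The Lorentz cone\<close>

lemma lorentz_cone_iff: "x \<in> lorentz_cone \<longleftrightarrow> norm (snd x) \<le> fst x"
  by (cases x) (simp add: lorentz_cone_def)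

lemma lorentz_cone_fst_nonneg: "x \<in> lorentz_cone \<Longrightarrow> 0 \<le> fst x"
  unfolding lorentz_cone_iff by (rule order_trans [OF norm_ge_zero])

lemma lorentz_cone_convex_cone: "convex_cone lorentz_cone"
proof -
  have "norm (snd x + snd y) \<le> fst x + fst y"
    if "norm (snd x) \<le> fst x" "norm (snd y) \<le> fst y" for x y :: "real \<times> (real ^ 'a)"
    using that norm_triangle_ineq [of "snd x" "snd y"] by linarith
  then show ?thesis
    by (simp add: convex_cone_iff lorentz_cone_iff mult_left_mono)
qed

lemma lorentz_cone_closed: "closed (lorentz_cone :: (real \<times> (real ^ 'n::finite)) set)"
proof -
  have "closed {x :: real \<times> (real ^ 'n). norm (snd x) \<le> fst x}"
    by (intro closed_Collect_le continuous_intros)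
  moreover have "lorentz_cone = {x :: real \<times> (real ^ 'n). norm (snd x) \<le> fst x}"
    by (auto simp: lorentz_cone_iff)
  ultimately show ?thesis by simp
qed

lemma lorentz_cone_pointed: "lorentz_cone \<inter> uminus ` lorentz_cone = {0}"
proof -
  have "x = 0" if "x \<in> lorentz_cone" "- x \<in> lorentz_cone" for x :: "real \<times> (real ^ 'a)"
  proof -
    have "norm (snd x) \<le> fst x" "norm (snd x) \<le> - fst x"
      using that by (simp_all add: lorentz_cone_iff)
    moreover have "0 \<le> norm (snd x)" by simp
    ultimately have "fst x = 0" "norm (snd x) = 0" by linarith+
    then show ?thesis by (simp add: prod_eq_iff)
  qed
  moreover have "0 \<in> (lorentz_cone :: (real \<times> (real ^ 'a)) set)" by (simp add: lorentz_cone_iff)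
  ultimately show ?thesis by (force simp: image_iff)
qed

lemma lorentz_cone_self_dual:
  "y \<in> lorentz_cone \<longleftrightarrow> (\<forall>x\<in>lorentz_cone. 0 \<le> y \<bullet> x)"
proof
  assume y: "y \<in> lorentz_cone"
  show "\<forall>x\<in>lorentz_cone. 0 \<le> y \<bullet> x"
  proof
    fix x :: "real \<times> (real ^ 'a)" assume x: "x \<in> lorentz_cone"
    have "\<bar>snd y \<bullet> snd x\<bar> \<le> norm (snd y) * norm (snd x)"
      by (rule Cauchy_Schwarz_ineq2)
    also have "\<dots> \<le> fst y * fst x"
      using x y by (intro mult_mono) (auto simp: lorentz_cone_iff lorentz_cone_fst_nonneg [OF y])
    finally show "0 \<le> y \<bullet> x" by (simp add: inner_prod_def)
  qed
next
  assume *: "\<forall>x\<in>lorentz_cone. 0 \<le> y \<bullet> x"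
  \<comment> \<open>The boundary vector opposite to \<open>snd y\<close> gives the sharp inequality
    after division by \<open>norm (snd y)\<close>; the axis vector settles the case
    \<open>snd y = 0\<close>.\<close>
  have "(norm (snd y), - snd y) \<in> lorentz_cone" "(1, 0) \<in> (lorentz_cone :: (real \<times> (real ^ 'a)) set)"
    by (simp_all add: lorentz_cone_iff)
  then have "0 \<le> y \<bullet> (norm (snd y), - snd y)" and 0: "0 \<le> y \<bullet> (1, 0)"
    using * by blast+
  then have "norm (snd y) * norm (snd y) \<le> fst y * norm (snd y)"
    by (simp add: inner_prod_def power2_norm_eq_inner [symmetric] power2_eq_square)
  with 0 show "y \<in> lorentz_cone"
    by (cases "snd y = 0") (auto simp: lorentz_cone_iff inner_prod_def)
qed

lemma linear_functional_inner:
  fixes \<phi> :: "'a::euclidean_space \<Rightarrow> real"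
  assumes "linear \<phi>"
  obtains y where "\<phi> = (\<lambda>x. y \<bullet> x)"
proof
  show "\<phi> = (\<lambda>x. adjoint \<phi> 1 \<bullet> x)"
    using adjoint_works [OF assms, of _ 1] by (simp add: fun_eq_iff inner_commute)
qed

lemma dual_lorentz_cone: "dual_cone lorentz_cone = (\<lambda>y x. y \<bullet> x) ` lorentz_cone"
proof
  show "dual_cone lorentz_cone \<subseteq> (\<lambda>y x. y \<bullet> x) ` (lorentz_cone :: (real \<times> (real ^ 'a)) set)"
  proof
    fix \<phi> :: "real \<times> (real ^ 'a) \<Rightarrow> real" assume \<phi>: "\<phi> \<in> dual_cone lorentz_cone"
    then obtain y where "\<phi> = (\<lambda>x. y \<bullet> x)"
      by (auto simp: dual_cone_def elim: linear_functional_inner)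
    with \<phi> show "\<phi> \<in> (\<lambda>y x. y \<bullet> x) ` lorentz_cone"
      using lorentz_cone_self_dual [of y] by (auto simp: dual_cone_def)
  qed
  show "(\<lambda>y x. y \<bullet> x) ` (lorentz_cone :: (real \<times> (real ^ 'a)) set) \<subseteq> dual_cone lorentz_cone"
  proof clarify
    fix y :: "real \<times> (real ^ 'a)" assume "y \<in> lorentz_cone"
    then show "(\<lambda>x. y \<bullet> x) \<in> dual_cone lorentz_cone"
      using lorentz_cone_self_dual [of y]
      by (simp add: dual_cone_def bounded_linear.linear [OF bounded_linear_inner_right])
  qed
qed

lemma lorentz_cone_bidual:
  assumes "\<And>\<phi>. \<phi> \<in> dual_cone lorentz_cone \<Longrightarrow> 0 \<le> \<phi> x"
  shows "x \<in> lorentz_cone"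
  unfolding lorentz_cone_self_dual
proof
  fix y assume "y \<in> (lorentz_cone :: (real \<times> (real ^ 'a)) set)"
  then have "0 \<le> y \<bullet> x" by (intro assms) (auto simp: dual_lorentz_cone)
  then show "0 \<le> x \<bullet> y" by (simp add: inner_commute)
qed

text \<open>By homogeneity: each vector of the cone is its first coordinate times (1, u) with u in
  the unit ball.\<close>

lemma multiform_lorentz_bound:
  assumes "\<And>us. length us = k \<Longrightarrow> (\<forall>u\<in>set us. norm u \<le> 1) \<Longrightarrow> \<bar>multiform a us\<bar> \<le> b"
    and "length xs = k" "set xs \<subseteq> lorentz_cone"
  shows "\<bar>multiform a (map snd xs)\<bar> \<le> b * prod_list (map fst xs)"
proof -
  \<comment> \<open>If \<open>fst x = 0\<close>, then \<open>snd x = 0\<close> by membership in the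
    cone, and division by zero gives the entry 0, so the rescaling identity below still
    holds.\<close>
  define us where "us = map (\<lambda>x. (1 / fst x) *\<^sub>R snd x) xs"
  have fst: "0 \<le> fst x" if "x \<in> set xs" for x
    using that assms(3) lorentz_cone_fst_nonneg by blast
  have "map snd xs = map2 (*\<^sub>R) (map fst xs) us"
    using assms(3) unfolding us_def
    by (induction xs) (auto simp: lorentz_cone_iff)
  then have "multiform a (map snd xs) = prod_list (map fst xs) * multiform a us"
    by (simp add: multiform_scale us_def)
  moreover have "\<bar>multiform a us\<bar> \<le> b"
  proof (rule assms(1))
    show "\<forall>u\<in>set us. norm u \<le> 1"
    proof
      fix u assume "u \<in> set us"
      then obtain x where x: "x \<in> set xs" and u: "u = (1 / fst x) *\<^sub>R snd x"
        by (auto simp: us_def)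
      have "norm u = norm (snd x) / fst x"
        using fst [OF x] by (simp add: u)
      also have "\<dots> \<le> 1"
        using x assms(3) fst [OF x] by (auto simp: lorentz_cone_iff divide_le_eq_1)
      finally show "norm u \<le> 1" .
    qed
  qed (simp add: us_def assms(2))
  moreover have "0 \<le> prod_list (map fst xs)"
    using fst by (induction xs) auto
  ultimately show ?thesis
    by (simp add: abs_mult mult.commute mult_right_mono)
qed

section \<open>The inequality obtained from a single tensor\<close>

lemma sum_fun_apply: "sum f A x = (\<Sum>a\<in>A. f a x)"
  for f :: "'a \<Rightarrow> 'b \<Rightarrow> 'c::comm_monoid_add"
  by (induction A rule: infinite_finite_induct) auto

lemma linear_snd_nth: "linear (\<lambda>v. snd v $ i)"
  by (rule linearI) auto

text \<open>The tensor and the functional used here are \<open>b e\<^sub>0\<^sup>\<otimes>\<^sup>k + A\<close> and \<open>b e\<^sub>0\<^sup>\<otimes>\<^sup>k - A\<close>. Replacing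
  \<open>A\<close> by \<open>-A\<close> and adding the two inequalities removes the terms that are linear in \<open>A\<close>.\<close>

lemma quadratic_form_le:
  fixes R :: "real \<times> (real ^ 'n::finite) \<Rightarrow> real \<times> (real ^ 'n)"
  assumes R: "linear R"
    and ann: "tensor_map R ` max_power lorentz_cone (Suc m) \<subseteq> min_power lorentz_cone (Suc m)"
    and bound: "\<And>us. length us = Suc m \<Longrightarrow> (\<forall>u\<in>set us. norm u \<le> 1) \<Longrightarrow> \<bar>multiform a us\<bar> \<le> b"
  shows "(\<Sum>I\<in>multi_indices (Suc m). \<Sum>J\<in>multi_indices (Suc m).
      a I * a J * prod_list (map2 (\<lambda>i j. snd (R (0, axis j 1)) $ i) I J)) \<le> b\<^sup>2 * fst (R (1, 0)) ^ Suc m"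
proof -
  let ?k = "Suc m"
  let ?I = "multi_indices ?k :: 'n list set"
  \<comment> \<open>\<open>e J\<close> and \<open>e0\<close> list basis vectors, \<open>p I\<close>
    and \<open>p0\<close> the coordinate functionals dual to them. Since tensors are represented as
    forms, evaluation at \<open>p I\<close> reads off a coordinate.\<close>
  define e where "e = (\<lambda>J :: 'n list. map (\<lambda>j. (0 :: real, axis j 1 :: real ^ 'n)) J)"
  define e0 where "e0 = replicate ?k (1 :: real, 0 :: real ^ 'n)"
  define p where "p = (\<lambda>I :: 'n list. map (\<lambda>i (v :: real \<times> (real ^ 'n)). snd v $ i) I)"
  define p0 where "p0 = replicate ?k (fst :: real \<times> (real ^ 'n) \<Rightarrow> real)"
  define T where "T = (\<lambda>c :: 'n list \<Rightarrow> real. b *\<^sub>R elementary_tensor e0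
      + (\<Sum>J\<in>?I. c J *\<^sub>R elementary_tensor (e J)))"
  \<comment> \<open>The sign opposite to that in \<open>T\<close> makes the quadratic term appear
    with a minus, hence bounded from above.\<close>
  define W where "W = (\<lambda>(c :: 'n list \<Rightarrow> real) S :: (real \<times> (real ^ 'n)) tensor.
      b * S p0 - (\<Sum>I\<in>?I. c I * S (p I)))"
  define E0 where "E0 = elementary_tensor (map R e0)"
  define E where "E = (\<lambda>J. elementary_tensor (map R (e J)))"
  have b0: "0 \<le> b"
    using bound [of "replicate ?k 0"] by auto
  have nonneg: "0 \<le> W c (tensor_map R (T c))"
    if c: "\<And>us. length us = ?k \<Longrightarrow> (\<forall>u\<in>set us. norm u \<le> 1) \<Longrightarrow> \<bar>multiform c us\<bar> \<le> b" for c
  proof -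
    have "T c \<in> max_power lorentz_cone ?k"
    proof (rule max_powerI [OF lorentz_cone_bidual])
      have elem: "elementary_tensor xs \<in> tensor_space ?k" if "length xs = ?k"
        for xs :: "(real \<times> (real ^ 'n)) list"
        using elementary_tensor_in_tensor_space [of xs] that
        by (simp del: tensor_space.simps) force
      have "elementary_tensor e0 \<in> tensor_space ?k"
        by (rule elem) (simp add: e0_def)
      moreover have "elementary_tensor (e J) \<in> tensor_space ?k" if "J \<in> ?I" for J
        by (rule elem) (use that in \<open>simp add: e_def multi_indices_def\<close>)
      ultimately show "T c \<in> tensor_space ?k"
        unfolding T_def
        by (intro subspace_add [OF subspace_tensor_space] subspace_scale [OF subspace_tensor_space]
            subspace_sum [OF subspace_tensor_space])
    next
      fix \<phi>s :: "(real \<times> (real ^ 'n) \<Rightarrow> real) list"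
      assume len: "length \<phi>s = ?k" and "set \<phi>s \<subseteq> dual_cone lorentz_cone"
      \<comment> \<open>Self-duality turns the test functionals into vectors of the cone, so this
        positivity check and the one for \<open>W\<close> both end in
        \<open>multiform_lorentz_bound\<close>.\<close>
      then have "\<phi>s \<in> lists ((\<lambda>y x. y \<bullet> x) ` (lorentz_cone :: (real \<times> (real ^ 'n)) set))"
        by (auto simp: dual_lorentz_cone)
      then obtain ys where ys: "set ys \<subseteq> (lorentz_cone :: (real \<times> (real ^ 'n)) set)"
        and \<phi>s: "\<phi>s = map (\<lambda>y x. y \<bullet> x) ys"
        by (auto simp: lists_image)
      have lin: "linear \<phi>" if "\<phi> \<in> set \<phi>s" for \<phi>
        using that by (auto simp: \<phi>s bounded_linear.linear [OF bounded_linear_inner_right])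
      have lys: "length ys = ?k" using len by (simp add: \<phi>s)
      have "elementary_tensor e0 \<phi>s = prod_list (map2 (\<lambda>\<phi> x. \<phi> x) \<phi>s e0)"
        by (rule elementary_tensor_apply) (use len lin in \<open>auto simp: e0_def\<close>)
      also have "map2 (\<lambda>\<phi> x. \<phi> x) \<phi>s e0 = map fst ys"
        using lys by (intro nth_equalityI) (auto simp: e0_def \<phi>s inner_prod_def nth_Cons' simp del: replicate_Suc)
      finally have 1: "elementary_tensor e0 \<phi>s = prod_list (map fst ys)" .
      have 2: "elementary_tensor (e J) \<phi>s = monomial (map snd ys) J" if "J \<in> ?I" for J
      proof -
        have "elementary_tensor (e J) \<phi>s = prod_list (map2 (\<lambda>\<phi> x. \<phi> x) \<phi>s (e J))"
          by (rule elementary_tensor_apply) (use len lin that in \<open>auto simp: e_def multi_indices_def\<close>)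
        also have "map2 (\<lambda>\<phi> x. \<phi> x) \<phi>s (e J) = map2 ($) (map snd ys) J"
          using lys that
          by (intro nth_equalityI)
             (auto simp: e_def \<phi>s multi_indices_def inner_prod_def inner_axis)
        finally show ?thesis by (simp add: monomial_def)
      qed
      have "T c \<phi>s = b * prod_list (map fst ys) + multiform c (map snd ys)"
        by (simp add: T_def sum_fun_apply 1 2 multiform_def lys)
      with multiform_lorentz_bound [OF c lys ys] show "0 \<le> T c \<phi>s" by linarith
    qed
    then have "tensor_map R (T c) \<in> min_power lorentz_cone ?k"
      using ann by blast
    then show ?thesis
    proof (rule min_power_nonneg)
      show "linear (W c)"
        by (rule linearI)
           (simp_all add: W_def algebra_simps sum.distrib sum_distrib_left)
      fix xs :: "(real \<times> (real ^ 'n)) list"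
      assume len: "length xs = ?k" and xs: "set xs \<subseteq> lorentz_cone"
      have "elementary_tensor xs p0 = prod_list (map2 (\<lambda>\<phi> x. \<phi> x) p0 xs)"
        by (rule elementary_tensor_apply)
           (use len in \<open>auto simp: p0_def linear_fst\<close>)
      also have "map2 (\<lambda>\<phi> x. \<phi> x) p0 xs = map fst xs"
        using len by (intro nth_equalityI) (auto simp: p0_def simp del: replicate_Suc)
      finally have 1: "elementary_tensor xs p0 = prod_list (map fst xs)" .
      have 2: "elementary_tensor xs (p I) = monomial (map snd xs) I" if "I \<in> ?I" for I
      proof -
        have "elementary_tensor xs (p I) = prod_list (map2 (\<lambda>\<phi> x. \<phi> x) (p I) xs)"
          by (rule elementary_tensor_apply)
             (use len that in \<open>auto simp: p_def multi_indices_def linear_snd_nth\<close>)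
        also have "map2 (\<lambda>\<phi> x. \<phi> x) (p I) xs = map2 ($) (map snd xs) I"
          using len that by (intro nth_equalityI) (auto simp: p_def multi_indices_def)
        finally show ?thesis by (simp add: monomial_def)
      qed
      have "W c (elementary_tensor xs) = b * prod_list (map fst xs) - multiform c (map snd xs)"
        by (simp add: W_def 1 2 multiform_def len)
      with multiform_lorentz_bound [OF c len xs] show "0 \<le> W c (elementary_tensor xs)"
        by linarith
    qed
  qed
  have WT: "W c (tensor_map R (T c)) = b\<^sup>2 * E0 p0 + b * (\<Sum>J\<in>?I. c J * E J p0)
      - b * (\<Sum>I\<in>?I. c I * E0 (p I)) - (\<Sum>I\<in>?I. \<Sum>J\<in>?I. c I * c J * E J (p I))" for c
  proof -
    have "tensor_map R (T c) = b *\<^sub>R E0 + (\<Sum>J\<in>?I. c J *\<^sub>R E J)"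
      by (simp add: T_def E0_def E_def linear_add [OF linear_tensor_map]
          linear_scale [OF linear_tensor_map] linear_sum [OF linear_tensor_map]
          tensor_map_elementary R)
    then show ?thesis
      by (simp add: W_def sum_fun_apply distrib_left sum.distrib sum_distrib_left
          power2_eq_square mult.assoc mult.left_commute)
  qed
  have "0 \<le> W a (tensor_map R (T a)) + W (\<lambda>I. - a I) (tensor_map R (T (\<lambda>I. - a I)))"
    using bound by (intro add_nonneg_nonneg nonneg) auto
  then have "(\<Sum>I\<in>?I. \<Sum>J\<in>?I. a I * a J * E J (p I)) \<le> b\<^sup>2 * E0 p0"
    by (simp add: WT sum_negf mult.commute [of "E0 p0"])
  moreover have "E0 p0 = fst (R (1, 0)) ^ ?k"
  proof -
    have "E0 p0 = prod_list (map2 (\<lambda>\<phi> x. \<phi> x) p0 (map R e0))"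
      unfolding E0_def
      by (rule elementary_tensor_apply) (auto simp: p0_def e0_def linear_fst)
    then show ?thesis by (simp add: p0_def e0_def zip_replicate prod_list_replicate del: replicate_Suc)
  qed
  moreover have "E J (p I) = prod_list (map2 (\<lambda>i j. snd (R (0, axis j 1)) $ i) I J)"
    if "I \<in> ?I" "J \<in> ?I" for I J
  proof -
    have "E J (p I) = prod_list (map2 (\<lambda>\<phi> x. \<phi> x) (p I) (map R (e J)))"
      unfolding E_def
      by (rule elementary_tensor_apply)
         (use that in \<open>auto simp: p_def e_def multi_indices_def linear_snd_nth\<close>)
    also have "map2 (\<lambda>\<phi> x. \<phi> x) (p I) (map R (e J)) = map2 (\<lambda>i j. snd (R (0, axis j 1)) $ i) I J"
      using that by (intro nth_equalityI) (auto simp: p_def e_def multi_indices_def)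
    finally show ?thesis .
  qed
  ultimately show ?thesis by simp
qed

section \<open>The trace of an entanglement annihilating map\<close>

text \<open>The trace of the \<open>k\<close>-th tensor power of the matrix
  \<open>f\<close>.\<close>

lemma sum_prod_list_diagonal:
  fixes f :: "'n::finite \<Rightarrow> 'n \<Rightarrow> real"
  shows "(\<Sum>I\<in>multi_indices k. prod_list (map2 f I I)) = (\<Sum>i\<in>UNIV. f i i) ^ k"
  by (induction k) (simp_all add: sum_multi_indices_Suc sum_distrib_right flip: sum_distrib_left)

text \<open>A finite net of mesh \<open>d\<close> in the ball, thickened by the vertices of a cube
  of half-width \<open>d\<close>: a point differs from some net point by an element of the cube. The
  vertices of the cube have l1-norm at most \<open>DIM('a) * d = r - 1\<close>.\<close>

lemma unit_ball_in_polytope: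
  fixes r :: real
  assumes "1 < r"
  obtains G :: "'a::euclidean_space set"
  where "finite G" "cball 0 1 \<subseteq> convex hull G" "\<And>g. g \<in> G \<Longrightarrow> norm g \<le> r"
proof -
  define d where "d = (r - 1) / DIM('a)"
  define w where "w = (\<Sum>i\<in>Basis. d *\<^sub>R i :: 'a)"
  have d: "0 < d" using assms by (simp add: d_def)
  obtain S :: "'a set" where S: "finite S" "cbox (0 - w) (0 + w) = convex hull S"
    unfolding w_def by (rule cube_convex_hull [OF d])
  have S_norm: "norm s \<le> r - 1" if "s \<in> S" for s
  proof -
    have "s \<in> cbox (0 - w) (0 + w)" using that S(2) hull_inc by metis
    then have "\<bar>s \<bullet> b\<bar> \<le> d" if "b \<in> Basis" for b
      using that by (auto simp: mem_box w_def inner_sum_left_Basis abs_le_iff dest!: bspec [of _ _ b])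
    then have "(\<Sum>b\<in>Basis. \<bar>s \<bullet> b\<bar>) \<le> (\<Sum>b\<in>(Basis :: 'a set). d)"
      by (rule sum_mono)
    then show ?thesis
      using norm_le_l1 [of s] by (simp add: d_def)
  qed
  have "seq_compact (cball (0 :: 'a) 1)"
    by (simp add: compact_imp_seq_compact)
  then obtain F where F: "finite F" "F \<subseteq> cball 0 1" "cball (0 :: 'a) 1 \<subseteq> (\<Union>x\<in>F. ball x d)"
    using seq_compact_imp_totally_bounded d by metis
  show thesis
  proof
    show "finite ((\<lambda>(x, s). x + s) ` (F \<times> S))" using F S by simp
    show "norm g \<le> r" if "g \<in> (\<lambda>(x, s). x + s) ` (F \<times> S)" for g
    proof -
      obtain x s where "g = x + s" "x \<in> F" "s \<in> S" using \<open>g \<in> _\<close> by auto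
      with F(2) S_norm [of s] norm_triangle_ineq [of x s] show ?thesis by auto
    qed
    show "cball 0 1 \<subseteq> convex hull ((\<lambda>(x, s). x + s) ` (F \<times> S))"
    proof
      fix y :: 'a assume "y \<in> cball 0 1"
      then obtain x where x: "x \<in> F" "dist x y < d" using F(3) by auto
      have "\<bar>(y - x) \<bullet> b\<bar> \<le> d" if "b \<in> Basis" for b
        using Basis_le_norm [OF that, of "y - x"] x(2) by (simp add: dist_norm norm_minus_commute)
      then have "y - x \<in> convex hull S"
        unfolding S(2) [symmetric] by (force simp: mem_box w_def inner_sum_left_Basis abs_le_iff)
      then have "x + (y - x) \<in> (+) x ` (convex hull S)" by blast
      also have "\<dots> = convex hull ((+) x ` S)" by (simp add: convex_hull_translation)
      also have "\<dots> \<subseteq> convex hull ((\<lambda>(x, s). x + s) ` (F \<times> S))"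
        using x(1) by (intro hull_mono) auto
      finally show "y \<in> convex hull ((\<lambda>(x, s). x + s) ` (F \<times> S))" by simp
    qed
  qed
qed

text \<open>Dominates the square of a maximum of linear forms by a sum of exponentials, whose mean over the
  signs factorizes; the maximum over \<open>card G ^ k\<close> points then costs only the factor \<open>l\<^sup>2 = (k * card G)\<^sup>2\<close>.\<close>

lemma power2_le_exp:
  fixes x l :: real
  assumes "0 \<le> l"
  shows "x\<^sup>2 \<le> 2 * l\<^sup>2 + 4 * exp (- l) * (exp x + exp (- x))"
proof (cases "\<bar>x\<bar> \<le> l")
  case True
  then have "x\<^sup>2 \<le> l\<^sup>2" by (simp add: abs_le_square_iff [symmetric])
  moreover have "0 \<le> 4 * exp (- l) * (exp x + exp (- x))" by simp
  moreover have "0 \<le> l\<^sup>2" by simp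
  ultimately show ?thesis by linarith
next
  case False
  define y where "y = \<bar>x\<bar> - l"
  have y: "0 \<le> y" using False by (simp add: y_def)
  have "x\<^sup>2 = (l + y)\<^sup>2" by (simp add: y_def)
  also have "\<dots> \<le> 2 * l\<^sup>2 + 2 * y\<^sup>2"
    using zero_le_power2 [of "l - y"] by (simp add: power2_eq_square algebra_simps)
  also have "y\<^sup>2 \<le> 2 * exp y"
    using exp_lower_Taylor_quadratic [OF y] y by simp
  also have "exp y = exp (- l) * exp \<bar>x\<bar>" by (simp add: y_def flip: exp_add)
  also have "exp \<bar>x\<bar> \<le> exp x + exp (- x)" by (simp add: abs_if)
  finally show ?thesis by (simp add: mult.assoc)
qed

text \<open>The average of \<open>quadratic_form_le\<close> over the sign arrays, with
  \<open>sqrt (B a)\<close> as bound for the array \<open>a\<close>. The left side averages to the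
  trace of a tensor power, the right side to the mean of \<open>B\<close>.\<close>

lemma trace_power_le:
  fixes R :: "real \<times> (real ^ 'n::finite) \<Rightarrow> real \<times> (real ^ 'n)" and G :: "(real ^ 'n) set"
  assumes R: "linear R"
    and ann: "tensor_map R ` max_power lorentz_cone k \<subseteq> min_power lorentz_cone k"
    and k: "0 < k" "even k"
    and G: "finite G" "cball 0 1 \<subseteq> convex hull G" "\<And>g. g \<in> G \<Longrightarrow> norm g \<le> \<rho>"
    and \<rho>: "0 < \<rho>"
  shows "(\<Sum>i\<in>UNIV. snd (R (0, axis i 1)) $ i) ^ k
    \<le> (\<rho> ^ k)\<^sup>2 * (2 * (real k * real (card G))\<^sup>2 + 24) * fst (R (1, 0)) ^ k"
proof -
  let ?I = "multi_indices k :: 'n list set"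
  let ?S = "sign_tensors k :: ('n list \<Rightarrow> real) set"
  define L where "L = {gs. set gs \<subseteq> G \<and> length gs = k}"
  \<comment> \<open>The threshold is taken just so that \<open>exp l\<close> exceeds the number of
    vertex tuples; \<open>card G <= exp (card G)\<close> replaces the logarithm.\<close>
  define l where "l = real k * real (card G)"
  define x where "x = (\<lambda>a (gs :: (real ^ 'n) list). multiform a gs / \<rho> ^ k)"
  \<comment> \<open>The bound of \<open>power2_le_exp\<close> for \<open>x a gs\<close>, with the
    exponentials summed over all tuples so that it serves every \<open>gs\<close> at once; the
    prefactor undoes the normalization in \<open>x\<close>.\<close>
  define B where "B = (\<lambda>a. (\<rho> ^ k)\<^sup>2 * (2 * l\<^sup>2 + 4 * exp (- l) * (\<Sum>gs\<in>L. exp (x a gs) + exp (- x a gs))))"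
  have l0: "0 \<le> l" by (simp add: l_def)
  have finL: "finite L" unfolding L_def using G(1) by (rule finite_lists_length_eq)
  have B0: "0 \<le> B a" for a
    unfolding B_def by (intro mult_nonneg_nonneg add_nonneg_nonneg sum_nonneg) auto
  have bound: "\<bar>multiform a us\<bar> \<le> sqrt (B a)"
    if len: "length us = k" and us: "\<forall>u\<in>set us. norm u \<le> 1" for a us
  proof (rule multiform_bound_hull [OF _ len])
    show "set us \<subseteq> convex hull G" using us G(2) by auto
    fix gs assume "length gs = k" "set gs \<subseteq> G"
    then have gs: "gs \<in> L" by (simp add: L_def)
    have "(x a gs)\<^sup>2 \<le> 2 * l\<^sup>2 + 4 * exp (- l) * (exp (x a gs) + exp (- x a gs))"
      by (rule power2_le_exp [OF l0])
    also have "\<dots> \<le> 2 * l\<^sup>2 + 4 * exp (- l) * (\<Sum>gs\<in>L. exp (x a gs) + exp (- x a gs))"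
      by (intro add_left_mono mult_left_mono member_le_sum [OF gs _ finL]) auto
    finally have "(\<rho> ^ k)\<^sup>2 * (x a gs)\<^sup>2 \<le> B a"
      unfolding B_def by (intro mult_left_mono) auto
    moreover have "(\<rho> ^ k)\<^sup>2 * (x a gs)\<^sup>2 = (multiform a gs)\<^sup>2"
      using \<rho> by (simp add: x_def power_divide)
    ultimately show "\<bar>multiform a gs\<bar> \<le> sqrt (B a)"
      by (intro real_le_rsqrt) simp
  qed
  obtain m where m: "k = Suc m" using k(1) by (cases k) auto
  have quad: "(\<Sum>I\<in>?I. \<Sum>J\<in>?I. a I * a J * prod_list (map2 (\<lambda>i j. snd (R (0, axis j 1)) $ i) I J))
      \<le> B a * fst (R (1, 0)) ^ k" for a
    using quadratic_form_le [OF R, of m a "sqrt (B a)"] ann bound B0 by (simp add: m)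
  have exp_sum_le: "(\<Sum>a\<in>?S. exp (s * x a gs)) \<le> real (card ?S) * 3"
    if gs: "gs \<in> L" and s: "s\<^sup>2 = 1" for s gs
  proof -
    have len: "length gs = k" using gs by (simp add: L_def)
    have "s * x a gs = (\<Sum>I\<in>?I. a I * (s * monomial gs I / \<rho> ^ k))" for a
      by (simp add: x_def multiform_def len sum_distrib_left sum_divide_distrib mult.left_commute)
    then have "(\<Sum>a\<in>?S. exp (s * x a gs)) = (\<Sum>a\<in>?S. exp (\<Sum>I\<in>?I. a I * (s * monomial gs I / \<rho> ^ k)))"
      by simp
    also have "\<dots> \<le> real (card ?S) * exp 1"
    proof (rule sum_exp_sign_tensors)
      \<comment> \<open>Division by \<open>\<rho> ^ k\<close> brings the coefficient vector of a
        vertex tuple into the unit ball, as the exponential moment bound requires.\<close>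
      have "prod_list (map norm gs) \<le> \<rho> ^ k"
        using gs unfolding L_def
      proof (clarsimp, induction gs arbitrary: k)
        case (Cons g gs)
        then show ?case using G(3) \<rho>
          by (auto intro!: mult_mono prod_list_nonneg)
      qed simp
      moreover have "0 \<le> prod_list (map norm gs)" by (rule prod_list_nonneg) auto
      ultimately have "(prod_list (map norm gs))\<^sup>2 \<le> (\<rho> ^ k)\<^sup>2"
        by (intro power_mono) auto
      then have "(\<Sum>I\<in>?I. (monomial gs I)\<^sup>2) / (\<rho> ^ k)\<^sup>2 \<le> 1"
        using sum_monomial_squared [of gs] \<rho> by (simp add: len divide_le_eq_1)
      then show "(\<Sum>I\<in>?I. (s * monomial gs I / \<rho> ^ k)\<^sup>2) \<le> 1"
        by (simp add: power_divide power_mult_distrib s sum_divide_distrib)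
    qed
    also have "\<dots> \<le> real (card ?S) * 3"
      \<comment> \<open>With the two signs \<open>s\<close> this gives 6 for each tuple, and the
        factor 4 in \<open>B\<close> makes 24.\<close>
      using exp_le by (intro mult_left_mono) auto
    finally show ?thesis .
  qed
  have "(\<Sum>a\<in>?S. \<Sum>gs\<in>L. exp (x a gs) + exp (- x a gs)) \<le> real (card L) * (real (card ?S) * 6)"
  proof -
    have "(\<Sum>a\<in>?S. \<Sum>gs\<in>L. exp (x a gs) + exp (- x a gs))
        = (\<Sum>gs\<in>L. (\<Sum>a\<in>?S. exp (1 * x a gs)) + (\<Sum>a\<in>?S. exp (- 1 * x a gs)))"
      by (subst sum.swap) (simp add: sum.distrib)
    also have "\<dots> \<le> (\<Sum>gs\<in>L. real (card ?S) * 3 + real (card ?S) * 3)"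
      by (intro sum_mono add_mono exp_sum_le) auto
    finally show ?thesis by simp
  qed
  moreover have "exp (- l) * real (card L) \<le> 1"
  proof -
    have "real (card L) = real (card G) ^ k"
      unfolding L_def by (simp add: card_lists_length_eq G(1))
    also have "\<dots> \<le> exp (real (card G)) ^ k"
      using exp_ge_add_one_self [of "real (card G)"] by (intro power_mono) linarith+
    also have "\<dots> = exp l" by (simp add: l_def exp_of_nat_mult)
    finally show ?thesis by (simp add: exp_minus field_simps)
  qed
  ultimately have "exp (- l) * (\<Sum>a\<in>?S. \<Sum>gs\<in>L. exp (x a gs) + exp (- x a gs)) \<le> real (card ?S) * 6"
  proof -
    assume 1: "(\<Sum>a\<in>?S. \<Sum>gs\<in>L. exp (x a gs) + exp (- x a gs)) \<le> real (card L) * (real (card ?S) * 6)"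
      and 2: "exp (- l) * real (card L) \<le> 1"
    have "exp (- l) * (\<Sum>a\<in>?S. \<Sum>gs\<in>L. exp (x a gs) + exp (- x a gs))
        \<le> exp (- l) * (real (card L) * (real (card ?S) * 6))"
      using 1 by (intro mult_left_mono) auto
    also have "\<dots> = (exp (- l) * real (card L)) * (real (card ?S) * 6)" by simp
    also have "\<dots> \<le> 1 * (real (card ?S) * 6)"
      using 2 by (intro mult_right_mono) auto
    finally show ?thesis by simp
  qed
  then have "real (card ?S) * (2 * l\<^sup>2) + 4 * (exp (- l) * (\<Sum>a\<in>?S. \<Sum>gs\<in>L. exp (x a gs) + exp (- x a gs)))
      \<le> real (card ?S) * (2 * l\<^sup>2 + 24)"
    by (simp add: algebra_simps)
  then have "(\<rho> ^ k)\<^sup>2 * (real (card ?S) * (2 * l\<^sup>2)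
        + 4 * (exp (- l) * (\<Sum>a\<in>?S. \<Sum>gs\<in>L. exp (x a gs) + exp (- x a gs))))
      \<le> (\<rho> ^ k)\<^sup>2 * (real (card ?S) * (2 * l\<^sup>2 + 24))"
    by (rule mult_left_mono) auto
  moreover have "(\<Sum>a\<in>?S. B a) = (\<rho> ^ k)\<^sup>2 * (real (card ?S) * (2 * l\<^sup>2)
        + 4 * (exp (- l) * (\<Sum>a\<in>?S. \<Sum>gs\<in>L. exp (x a gs) + exp (- x a gs))))"
    by (simp add: B_def sum_distrib_left [symmetric] sum.distrib mult.assoc mult.left_commute)
  ultimately have sumB: "(\<Sum>a\<in>?S. B a) \<le> real (card ?S) * ((\<rho> ^ k)\<^sup>2 * (2 * l\<^sup>2 + 24))"
    by (simp add: mult_ac)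
  have "real (card ?S) * (\<Sum>i\<in>UNIV. snd (R (0, axis i 1)) $ i) ^ k
      = (\<Sum>a\<in>?S. \<Sum>I\<in>?I. \<Sum>J\<in>?I. a I * a J * prod_list (map2 (\<lambda>i j. snd (R (0, axis j 1)) $ i) I J))"
    by (simp add: sum_sign_tensors_quadratic sum_prod_list_diagonal)
  also have "\<dots> \<le> (\<Sum>a\<in>?S. B a * fst (R (1, 0)) ^ k)"
    by (intro sum_mono quad)
  also have "\<dots> = (\<Sum>a\<in>?S. B a) * fst (R (1, 0)) ^ k"
    by (simp add: sum_distrib_right)
  also have "\<dots> \<le> (real (card ?S) * ((\<rho> ^ k)\<^sup>2 * (2 * l\<^sup>2 + 24))) * fst (R (1, 0)) ^ k"
    \<comment> \<open>Evenness of \<open>k\<close> makes the power of \<open>fst (R (1, 0))\<close>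
      nonnegative.\<close>
    using k(2) by (intro mult_right_mono sumB) (simp add: zero_le_even_power)
  finally have "real (card ?S) * (\<Sum>i\<in>UNIV. snd (R (0, axis i 1)) $ i) ^ k
      \<le> real (card ?S) * ((\<rho> ^ k)\<^sup>2 * (2 * l\<^sup>2 + 24) * fst (R (1, 0)) ^ k)"
    by (simp add: mult_ac)
  moreover have "0 < real (card ?S)" by (simp add: card_PiE)
  ultimately show ?thesis by (simp add: l_def)
qed

text \<open>For \<open>k = 2 * n\<close>, division by \<open>q ^ k\<close> leaves a combination of
  the squares of n q^(-n) and q^(-n), both tending to 0.\<close>

lemma quadratic_less_power:
  fixes q A B :: real
  assumes "1 < q"
  obtains k :: nat where "0 < k" "even k" "A * (real k)\<^sup>2 + B < q ^ k"
proof -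
  have "(\<lambda>n. real n * (1 / q) ^ n) \<longlonglongrightarrow> 0"
    using powser_times_n_limit_0 [of "1 / q"] assms by simp
  then have "(\<lambda>n. 4 * A * (real n * (1 / q) ^ n)\<^sup>2 + B * ((1 / q) ^ n)\<^sup>2) \<longlonglongrightarrow> 4 * A * 0\<^sup>2 + B * 0\<^sup>2"
    using assms by (intro tendsto_intros LIMSEQ_power_zero) auto
  then have "\<forall>\<^sub>F n in sequentially. 4 * A * (real n * (1 / q) ^ n)\<^sup>2 + B * ((1 / q) ^ n)\<^sup>2 < 1"
    by (rule order_tendstoD) simp
  then obtain n :: nat where "4 * A * (real n * (1 / q) ^ n)\<^sup>2 + B * ((1 / q) ^ n)\<^sup>2 < 1" "1 \<le> n"
    by (metis (mono_tags, lifting) eventually_sequentially nle_le)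
  then have "(A * (real (2 * n))\<^sup>2 + B) / (q ^ n)\<^sup>2 < 1"
    by (simp add: power_mult_distrib power_divide add_divide_distrib mult_ac)
  moreover have "0 < (q ^ n)\<^sup>2" using assms by simp
  ultimately have "A * (real (2 * n))\<^sup>2 + B < (q ^ n)\<^sup>2"
    by (simp add: divide_less_eq)
  also have "(q ^ n)\<^sup>2 = q ^ (2 * n)"
    by (simp add: power_mult [symmetric] mult.commute)
  finally show thesis using \<open>1 \<le> n\<close> by (intro that [of "2 * n"]) auto
qed

text \<open>The sum is the trace of \<open>R\<close>. Were it negative, \<open>t\<close> would
  exceed \<open>r\<close>, and the powers of the two would differ by more than
  \<open>trace_power_le\<close> allows.\<close>

lemma annihilating_trace_nonneg:
  fixes R :: "real \<times> (real ^ 'n::finite) \<Rightarrow> real \<times> (real ^ 'n)"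
  assumes "entanglement_annihilating lorentz_cone lorentz_cone R"
  shows "0 \<le> fst (R (1, 0)) + (\<Sum>i\<in>UNIV. snd (R (0, axis i 1)) $ i)"
proof (rule ccontr)
  assume neg: "\<not> ?thesis"
  define t where "t = - (\<Sum>i\<in>UNIV. snd (R (0, axis i 1)) $ i)"
  define r where "r = fst (R (1, 0))"
  have rt: "r < t" using neg by (simp add: r_def t_def)
  have R: "linear R"
    and ann: "\<And>k. 1 \<le> k \<Longrightarrow> tensor_map R ` max_power lorentz_cone k \<subseteq> min_power lorentz_cone k"
    using assms by (auto simp: entanglement_annihilating_def)
  \<comment> \<open>The power \<open>k = 1\<close> of the hypothesis shows that \<open>R\<close>
    maps the axis vector into the cone, whence \<open>0 \<le> r\<close>.\<close>
  have "(1, 0) \<in> (lorentz_cone :: (real \<times> (real ^ 'n)) set)"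
    by (simp add: lorentz_cone_iff)
  then have "tensor_of (R (1, 0)) \<in> tensor_of ` (lorentz_cone :: (real \<times> (real ^ 'n)) set)"
    using ann [of 1] tensor_map_of [OF R] by force
  then obtain y :: "real \<times> (real ^ 'n)"
    where y: "y \<in> lorentz_cone" "tensor_of (R (1, 0)) = tensor_of y" by auto
  have "tensor_of z [fst] = fst z" for z :: "real \<times> (real ^ 'n)"
    by (simp add: tensor_of_def tensor_cons_def scalar_one_def linear_fst)
  with y have r0: "0 \<le> r"
    by (metis lorentz_cone_fst_nonneg r_def)
  \<comment> \<open>The gap is split in three: \<open>c\<close> is positive even if
    \<open>r = 0\<close>, the ratio \<open>d / c\<close> absorbs the loss
    \<open>\<rho>\<^sup>2\<close> of the polytope, and \<open>t / d\<close> outgrows the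
    polynomial.\<close>
  obtain c d where c: "r < c" and d: "c < d" "d < t"
    using dense rt by metis
  have c0: "0 < c" using r0 c by simp
  define \<rho> where "\<rho> = sqrt (d / c)"
  have \<rho>: "1 < \<rho>" "\<rho>\<^sup>2 * c = d"
    using c0 d by (simp_all add: \<rho>_def)
  obtain G :: "(real ^ 'n) set"
    where G: "finite G" "cball 0 1 \<subseteq> convex hull G" "\<And>g. g \<in> G \<Longrightarrow> norm g \<le> \<rho>"
    using unit_ball_in_polytope [OF \<rho>(1)] by metis
  have "1 < t / d" using c0 d by (simp add: divide_less_eq)
  then obtain k :: nat where k: "0 < k" "even k"
    and less: "2 * (real (card G))\<^sup>2 * (real k)\<^sup>2 + 24 < (t / d) ^ k"
    by (rule quadratic_less_power)
  have "t ^ k = (\<Sum>i\<in>UNIV. snd (R (0, axis i 1)) $ i) ^ k"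
    using k(2) by (simp add: t_def)
  also have "\<dots> \<le> (\<rho> ^ k)\<^sup>2 * (2 * (real k * real (card G))\<^sup>2 + 24) * r ^ k"
    unfolding r_def using k \<rho> ann [of k] by (intro trace_power_le [OF R _ k G]) auto
  also have "\<dots> \<le> (\<rho> ^ k)\<^sup>2 * (2 * (real k * real (card G))\<^sup>2 + 24) * c ^ k"
    using r0 c by (intro mult_left_mono power_mono) auto
  also have "\<dots> = (2 * (real (card G))\<^sup>2 * (real k)\<^sup>2 + 24) * d ^ k"
    unfolding \<rho>(2) [symmetric]
    by (simp add: power_mult_distrib power_mult [symmetric] mult_ac)
  also have "\<dots> < (t / d) ^ k * d ^ k"
    using less c0 d by (intro mult_strict_right_mono) auto
  also have "\<dots> = t ^ k"
    using c0 d by (simp add: power_divide)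
  finally show False by simp
qed

section \<open>Duality with the cone of entanglement breaking maps\<close>

lemma closed_convex_cone_separation:
  fixes K :: "'a::euclidean_space set"
  assumes K: "convex_cone K" "closed K" and "p \<notin> K"
  obtains a where "a \<bullet> p < 0" "\<And>z. z \<in> K \<Longrightarrow> 0 \<le> a \<bullet> z"
proof -
  have "convex K" using K(1) by (simp add: convex_cone_def)
  then obtain a b where ab: "a \<bullet> p < b" "\<And>z. z \<in> K \<Longrightarrow> b < a \<bullet> z"
    using separating_hyperplane_closed_point [OF _ K(2) assms(3)] by metis
  have b: "b < 0" using ab(2) [OF convex_cone_contains_0 [OF K(1)]] by simp
  show thesis
  proof
    show "a \<bullet> p < 0" using ab(1) b by simp
    show "0 \<le> a \<bullet> z" if z: "z \<in> K" for z
    proof (rule ccontr)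
      assume neg: "\<not> 0 \<le> a \<bullet> z"
      then have "0 \<le> b / (a \<bullet> z)" using b by (simp add: divide_nonpos_neg)
      \<comment> \<open>This multiple of \<open>z\<close> lies on the hyperplane with value
        \<open>b\<close>, against strict separation.\<close>
      then have "(b / (a \<bullet> z)) *\<^sub>R z \<in> K" using K(1) z by (intro convex_cone_scaleR)
      then show False using ab(2) neg by fastforce
    qed
  qed
qed

text \<open>Pointedness makes \<open>D - {0}\<close> convex, so the compact hull of the unit vectors
  of \<open>D\<close> misses 0 and can be strictly separated from it.\<close>

lemma pointed_cone_positive_functional:
  fixes D :: "'a::euclidean_space set"
  assumes D: "convex_cone D" "closed D" and pointed: "D \<inter> uminus ` D \<subseteq> {0}"
  obtains f where "\<And>x. x \<in> D \<Longrightarrow> x \<noteq> 0 \<Longrightarrow> 0 < f \<bullet> x"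
proof -
  let ?S = "D \<inter> sphere 0 1"
  have "convex (D - {0})"
  proof (rule convexI)
    fix x y and u v :: real
    assume x: "x \<in> D - {0}" and y: "y \<in> D - {0}" and uv: "0 \<le> u" "0 \<le> v" "u + v = 1"
    have ux: "u *\<^sub>R x \<in> D" and vy: "v *\<^sub>R y \<in> D"
      using D(1) x y uv by (auto intro: convex_cone_scaleR)
    have "u *\<^sub>R x + v *\<^sub>R y \<noteq> 0"
    proof
      assume "u *\<^sub>R x + v *\<^sub>R y = 0"
      then have "u *\<^sub>R x = - (v *\<^sub>R y)" by (simp add: eq_neg_iff_add_eq_0)
      then have "u *\<^sub>R x \<in> D \<inter> uminus ` D" using ux vy by auto
      then have "u *\<^sub>R x = 0" using pointed by auto
      with \<open>u *\<^sub>R x = - (v *\<^sub>R y)\<close> x y uv(3) show False by auto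
    qed
    then show "u *\<^sub>R x + v *\<^sub>R y \<in> D - {0}"
      using convex_cone_add [OF D(1) ux vy] by simp
  qed
  then have "convex hull ?S \<subseteq> D - {0}"
    by (intro hull_minimal) auto
  moreover have "compact (convex hull ?S)"
    using D(2) by (intro compact_convex_hull closed_Int_compact) auto
  ultimately obtain a b where ab: "0 < b" "\<And>x. x \<in> convex hull ?S \<Longrightarrow> b < a \<bullet> x"
    using separating_hyperplane_closed_0 [of "convex hull ?S"] compact_imp_closed by blast
  show thesis
  proof
    fix x assume x: "x \<in> D" "x \<noteq> 0"
    then have "(1 / norm x) *\<^sub>R x \<in> ?S"
      using D(1) by (auto intro: convex_cone_scaleR)
    then have "0 < a \<bullet> ((1 / norm x) *\<^sub>R x)"
      using ab hull_inc by (metis less_trans)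
    then show "0 < a \<bullet> x" using x(2) by (simp add: zero_less_divide_iff)
  qed
qed

text \<open>The space \<open>(\<real> \<oplus> \<real>\<^sup>n) \<otimes> E\<close> is represented by \<open>E \<times> E\<^sup>n\<close>.\<close>

definition simple_tensor :: "real \<times> (real ^ 'n) \<Rightarrow> 'e::real_vector \<Rightarrow> 'e \<times> ('e ^ 'n)" where
  "simple_tensor y x = (fst y *\<^sub>R x, \<chi> i. snd y $ i *\<^sub>R x)"

text \<open>An element \<open>q\<close> read as a linear map from the Lorentz space to
  \<open>'e\<close>; \<open>cocontract\<close> is the adjoint map, see
  \<open>inner_contract\<close>.\<close>

definition contract :: "real \<times> (real ^ 'n::finite) \<Rightarrow> 'e::real_vector \<times> ('e ^ 'n) \<Rightarrow> 'e" where
  "contract y q = fst y *\<^sub>R fst q + (\<Sum>i\<in>UNIV. snd y $ i *\<^sub>R snd q $ i)"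

definition cocontract :: "'e::real_inner \<times> ('e ^ 'n::finite) \<Rightarrow> 'e \<Rightarrow> real \<times> (real ^ 'n)" where
  "cocontract q x = (fst q \<bullet> x, \<chi> i. snd q $ i \<bullet> x)"

lemma linear_contract_left: "linear (\<lambda>y. contract y q)"
  by (rule linearI)
     (simp_all add: contract_def algebra_simps sum.distrib scaleR_sum_right)

lemma linear_contract_right: "linear (contract y)"
  by (rule linearI)
     (simp_all add: contract_def algebra_simps sum.distrib scaleR_sum_right)

lemma linear_cocontract: "linear (cocontract q)"
  by (rule linearI) (simp_all add: cocontract_def inner_simps vec_eq_iff)

lemma contract_simple_tensor: "contract v (simple_tensor y x) = (y \<bullet> v) *\<^sub>R x"
  by (simp add: contract_def simple_tensor_def inner_prod_def inner_vec_def
      scaleR_add_left scaleR_sum_left mult.commute)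

lemma inner_simple_tensor: "q \<bullet> simple_tensor y x = y \<bullet> cocontract q x"
  by (simp add: simple_tensor_def cocontract_def inner_prod_def inner_vec_def)

lemma inner_contract: "contract y q \<bullet> x = y \<bullet> cocontract q x"
  by (simp add: contract_def cocontract_def inner_prod_def inner_vec_def inner_simps inner_sum_left)

lemma contract_basis [simp]:
  "contract (1, 0) q = fst q" "contract (0, axis i 1) q = snd q $ i"
proof -
  show "contract (1, 0) q = fst q" by (simp add: contract_def)
  have "(\<Sum>j\<in>UNIV. axis i 1 $ j *\<^sub>R snd q $ j) = (\<Sum>j\<in>UNIV. if j = i then snd q $ j else 0)"
    by (rule sum.cong) (auto simp: axis_def)
  then show "contract (0, axis i 1) q = snd q $ i" by (simp add: contract_def)
qed

lemma linear_eq_contract: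
  assumes "linear f"
  shows "f v = contract v (f (1, 0), \<chi> i. f (0, axis i 1))"
proof -
  have "v = fst v *\<^sub>R (1, 0) + (\<Sum>i\<in>UNIV. snd v $ i *\<^sub>R (0, axis i 1))"
    using basis_expansion [of "snd v"]
    by (simp add: prod_eq_iff fst_sum snd_sum scalar_mult_eq_scaleR)
  then have "f v = f (fst v *\<^sub>R (1, 0) + (\<Sum>i\<in>UNIV. snd v $ i *\<^sub>R (0, axis i 1)))"
    by simp
  then show ?thesis
    by (simp only: contract_def linear_add [OF assms] linear_sum [OF assms]
        linear_scale [OF assms] fst_conv snd_conv vec_lambda_beta)
qed

lemma scaled_simple_tensor:
  "(a * b) *\<^sub>R simple_tensor y x = simple_tensor (a *\<^sub>R y) (b *\<^sub>R x)"
  by (simp add: simple_tensor_def vec_eq_iff mult_ac)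

text \<open>Separation from the cone spanned by the simple tensors, once that cone is known to be
  closed. The separating \<open>q\<close> is nonnegative on all simple tensors, which by
  self-duality says that \<open>cocontract q\<close> is a positive map.\<close>

lemma lorentz_tensor_alternative:
  fixes D :: "'e::euclidean_space set" and p :: "'e \<times> ('e ^ 'n::finite)"
  assumes D: "convex_cone D" "closed D" and pointed: "D \<inter> uminus ` D \<subseteq> {0}"
  obtains
    (decomposed) k y x where "\<And>i::nat. i \<in> {1..k} \<Longrightarrow> y i \<in> lorentz_cone \<and> x i \<in> D"
      "p = (\<Sum>i=1..k. simple_tensor (y i) (x i))"
  | (separated) q where "\<And>x. x \<in> D \<Longrightarrow> cocontract q x \<in> lorentz_cone" "q \<bullet> p < 0"
proof -
  define S where "S = (\<lambda>(u, x). simple_tensor (1, u) x) ` (cball (0 :: real ^ 'n) 1 \<times> (D \<inter> sphere 0 1))"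
  let ?K = "convex_cone hull S"
  have "continuous_on UNIV (\<lambda>(u :: real ^ 'n, x :: 'e). simple_tensor (1, u) x)"
    unfolding simple_tensor_def case_prod_unfold
    by (intro continuous_intros continuous_on_vec_lambda)
  then have "compact S"
    unfolding S_def using D(2)
    by (intro compact_continuous_image compact_Times closed_Int_compact)
       (auto intro: continuous_on_subset)
  obtain f where f: "\<And>x. x \<in> D \<Longrightarrow> x \<noteq> 0 \<Longrightarrow> 0 < f \<bullet> x"
    using pointed_cone_positive_functional [OF D pointed] by metis
  \<comment> \<open>The first component of a generator is \<open>x\<close> itself, so
    \<open>(f, 0)\<close> is positive on \<open>S\<close>. Hence the hull of \<open>S\<close> misses
    0, and the cone over a compact set missing 0 is closed.\<close>
  have "S \<subseteq> {z. 0 < (f, 0) \<bullet> z}"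
    using f by (fastforce simp: S_def simple_tensor_def inner_prod_def)
  then have "convex hull S \<subseteq> {z. 0 < (f, 0) \<bullet> z}"
    by (intro hull_minimal) (auto simp: convex_halfspace_gt)
  then have "0 \<notin> convex hull S" by auto
  then have closed: "closed ?K"
    unfolding convex_cone_hull_separate
    using compact_convex_hull [OF \<open>compact S\<close>] by (simp add: closed_conic_hull closed_insert)
  show thesis
  proof (cases "p \<in> ?K")
    case True
    then consider "p = 0" | c z where "0 \<le> c" "z \<in> convex hull S" "p = c *\<^sub>R z"
      by (auto simp: convex_cone_hull_convex_hull)
    then show thesis
    proof cases
      case 1
      then show thesis using decomposed [of 0] by simp
    next
      case 2
      from 2(2) obtain k :: nat and w s
        where ws: "\<And>i. i \<in> {1..k} \<Longrightarrow> 0 \<le> w i \<and> s i \<in> S" and z: "z = (\<Sum>i=1..k. w i *\<^sub>R s i)"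
        unfolding convex_hull_indexed by blast
      have "\<forall>i\<in>{1..k}. \<exists>yx. fst yx \<in> lorentz_cone \<and> snd yx \<in> D \<and> s i = simple_tensor (fst yx) (snd yx)"
      proof
        fix i assume "i \<in> {1..k}"
        with ws have "s i \<in> S" by blast
        then obtain u x where "norm u \<le> 1" "x \<in> D" "s i = simple_tensor (1, u) x"
          by (auto simp: S_def)
        then show "\<exists>yx. fst yx \<in> lorentz_cone \<and> snd yx \<in> D \<and> s i = simple_tensor (fst yx) (snd yx)"
          by (intro exI [of _ "((1, u), x)"]) (simp add: lorentz_cone_iff)
      qed
      then obtain yx where yx: "\<And>i. i \<in> {1..k} \<Longrightarrow>
          fst (yx i) \<in> lorentz_cone \<and> snd (yx i) \<in> D \<and> s i = simple_tensor (fst (yx i)) (snd (yx i))"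
        by metis
      show thesis
      proof (rule decomposed)
        show "fst (yx i) \<in> lorentz_cone \<and> (c * w i) *\<^sub>R snd (yx i) \<in> D" if "i \<in> {1..k}" for i
          using yx [OF that] ws [OF that] 2(1) D(1) by (auto intro: convex_cone_scaleR)
        have "p = (\<Sum>i=1..k. (1 * (c * w i)) *\<^sub>R s i)"
          by (simp add: 2(3) z scaleR_sum_right)
        also have "\<dots> = (\<Sum>i=1..k. simple_tensor (fst (yx i)) ((c * w i) *\<^sub>R snd (yx i)))"
        proof (rule sum.cong)
          fix i assume i: "i \<in> {1..k}"
          then show "(1 * (c * w i)) *\<^sub>R s i = simple_tensor (fst (yx i)) ((c * w i) *\<^sub>R snd (yx i))"
            using yx [OF i] scaled_simple_tensor [of 1 "c * w i" "fst (yx i)" "snd (yx i)"]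
            by simp
        qed simp
        finally show "p = (\<Sum>i=1..k. simple_tensor (fst (yx i)) ((c * w i) *\<^sub>R snd (yx i)))" .
      qed
    qed
  next
    case False
    then obtain q where q: "q \<bullet> p < 0" "\<And>z. z \<in> ?K \<Longrightarrow> 0 \<le> q \<bullet> z"
      using closed_convex_cone_separation [OF convex_cone_convex_cone_hull closed] by metis
    have "0 \<le> q \<bullet> simple_tensor y x" if y: "y \<in> lorentz_cone" and x: "x \<in> D" for y x
    proof (cases "fst y = 0 \<or> x = 0")
      case True
      then have "simple_tensor y x = 0"
        \<comment> \<open>In the cone, \<open>fst y = 0\<close> forces \<open>y = 0\<close>.\<close>
        using y by (auto simp: simple_tensor_def lorentz_cone_iff zero_prod_def vec_eq_iff)
      then show ?thesis by simp
    next
      case False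
      then have pos: "0 < fst y" "0 < norm x"
        using lorentz_cone_fst_nonneg [OF y] by auto
      have "simple_tensor (1, (1 / fst y) *\<^sub>R snd y) ((1 / norm x) *\<^sub>R x) \<in> S"
        unfolding S_def using y x pos D(1)
        by (intro image_eqI [of _ _ "((1 / fst y) *\<^sub>R snd y, (1 / norm x) *\<^sub>R x)"])
           (auto simp: lorentz_cone_iff divide_le_eq_1 intro: convex_cone_scaleR)
      then have "0 \<le> q \<bullet> simple_tensor (1, (1 / fst y) *\<^sub>R snd y) ((1 / norm x) *\<^sub>R x)"
        by (intro q(2) hull_inc)
      then have "0 \<le> (fst y * norm x) * (q \<bullet> simple_tensor (1, (1 / fst y) *\<^sub>R snd y) ((1 / norm x) *\<^sub>R x))"
        using pos by (intro mult_nonneg_nonneg) auto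
      also have "\<dots> = q \<bullet> ((fst y * norm x) *\<^sub>R simple_tensor (1, (1 / fst y) *\<^sub>R snd y) ((1 / norm x) *\<^sub>R x))"
        by simp
      also have "\<dots> = q \<bullet> simple_tensor y x"
        unfolding scaled_simple_tensor using pos by simp
      finally show ?thesis .
    qed
    then have "cocontract q x \<in> lorentz_cone" if "x \<in> D" for x
      using that lorentz_cone_self_dual [of "cocontract q x"]
      by (simp add: inner_simple_tensor inner_commute [of "cocontract q x"])
    with q(1) show thesis using separated by blast
  qed
qed

section \<open>Resilience\<close>

text \<open>A positive map applied afterwards preserves minimal powers; in
  \<open>entanglement_annihilating_comp_right\<close> one applied beforehand preserves maximal
  powers.\<close>

lemma entanglement_annihilating_comp_left:
  assumes "entanglement_annihilating C\<^sub>1 C\<^sub>2 P" "linear Q" "Q ` C\<^sub>2 \<subseteq> C\<^sub>3"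
  shows "entanglement_annihilating C\<^sub>1 C\<^sub>3 (Q \<circ> P)"
  unfolding entanglement_annihilating_def
proof (intro conjI allI impI subsetI)
  have P: "linear P" using assms(1) by (simp add: entanglement_annihilating_def)
  then show "linear (Q \<circ> P)" using assms(2) by (rule linear_compose)
  fix k :: nat and S assume "1 \<le> k" and "S \<in> tensor_map (Q \<circ> P) ` max_power C\<^sub>1 k"
  then obtain m T where m: "k = Suc m" and "T \<in> max_power C\<^sub>1 k" "S = tensor_map Q (tensor_map P T)"
    using tensor_map_compose [OF P assms(2)] by (cases k) auto
  then have "tensor_map P T \<in> min_power C\<^sub>2 (Suc m)"
    using assms(1) by (force simp: entanglement_annihilating_def)
  with tensor_map_min_power [OF assms(2,3)] show "S \<in> min_power C\<^sub>3 k"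
    using \<open>S = _\<close> m by blast
qed

lemma entanglement_annihilating_comp_right:
  assumes "entanglement_annihilating C\<^sub>1 C\<^sub>2 P" "linear Q" "Q ` C\<^sub>0 \<subseteq> C\<^sub>1"
  shows "entanglement_annihilating C\<^sub>0 C\<^sub>2 (P \<circ> Q)"
  unfolding entanglement_annihilating_def
proof (intro conjI allI impI subsetI)
  have P: "linear P" using assms(1) by (simp add: entanglement_annihilating_def)
  with assms(2) show "linear (P \<circ> Q)" by (rule linear_compose)
  fix k :: nat and S assume "1 \<le> k" and "S \<in> tensor_map (P \<circ> Q) ` max_power C\<^sub>0 k"
  then obtain m T where m: "k = Suc m" and T: "T \<in> max_power C\<^sub>0 k" "S = tensor_map P (tensor_map Q T)"
    using tensor_map_compose [OF assms(2) P] by (cases k) auto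
  then have "tensor_map Q T \<in> max_power C\<^sub>1 k"
    using tensor_map_max_power [OF assms(2,3)] by blast
  with assms(1) T(2) \<open>1 \<le> k\<close> show "S \<in> min_power C\<^sub>2 k"
    by (force simp: entanglement_annihilating_def)
qed

lemma linear_inv_bij:
  assumes "linear \<kappa>" "bij \<kappa>"
  shows "linear (inv \<kappa>)"
proof (rule linearI)
  have *: "inv \<kappa> v = x" if "\<kappa> x = v" for v x
    using assms(2) that by (auto simp: bij_is_inj)
  have \<kappa>: "\<kappa> (inv \<kappa> v) = v" for v
    using assms(2) by (simp add: bij_is_surj surj_f_inv_f)
  show "inv \<kappa> (v + w) = inv \<kappa> v + inv \<kappa> w" for v w
    by (rule *) (simp add: linear_add [OF assms(1)] \<kappa>)
  show "inv \<kappa> (r *\<^sub>R v) = r *\<^sub>R inv \<kappa> v" for r v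
    by (rule *) (simp add: linear_scale [OF assms(1)] \<kappa>)
qed

text \<open>\<open>\<kappa>\<close> supplies coordinates with an inner product, in which
  \<open>C\<close> becomes \<open>D\<close> and \<open>P\<close> becomes the element
  \<open>p\<close>. A decomposition of \<open>p\<close> into simple tensors is an entanglement
  breaking form of \<open>P\<close>.\<close>

lemma resilient_lorentz_left:
  fixes \<kappa> :: "'e::euclidean_space \<Rightarrow> 'b::real_normed_vector" and C :: "'b set"
  assumes \<kappa>: "linear \<kappa>" "bij \<kappa>"
    and C: "convex_cone C" "closed C" and pointed: "C \<inter> uminus ` C = {0}"
  shows "resilient (lorentz_cone :: (real \<times> (real ^ 'n::finite)) set) C"
  unfolding resilient_def
proof (intro allI impI)
  fix P :: "real \<times> (real ^ 'n) \<Rightarrow> 'b" assume ann: "entanglement_annihilating lorentz_cone C P"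
  then have P: "linear P" by (simp add: entanglement_annihilating_def)
  define \<iota> where "\<iota> = inv \<kappa>"
  have \<iota>: "linear \<iota>" "\<And>w. \<kappa> (\<iota> w) = w"
    unfolding \<iota>_def using linear_inv_bij [OF \<kappa>] \<kappa>(2) by (simp_all add: bij_is_surj surj_f_inv_f)
  define D where "D = \<kappa> -` C"
  define p where "p = (\<iota> (P (1, 0)), \<chi> i. \<iota> (P (0, axis i 1)))"
  have "convex_cone D"
    using C(1) by (auto simp: D_def convex_cone_iff linear_0 [OF \<kappa>(1)] linear_add [OF \<kappa>(1)] linear_scale [OF \<kappa>(1)])
  moreover have "closed D"
    unfolding D_def using C(2) linear_continuous_on [of \<kappa> UNIV] \<kappa>(1)
    by (intro closed_vimage) (auto simp: linear_conv_bounded_linear)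
  moreover have "D \<inter> uminus ` D \<subseteq> {0}"
  proof
    fix x assume "x \<in> D \<inter> uminus ` D"
    then have "\<kappa> x \<in> C" "- \<kappa> x \<in> C" by (auto simp: D_def linear_neg [OF \<kappa>(1)])
    then have "\<kappa> x \<in> C \<inter> uminus ` C" by (metis IntI imageI minus_minus)
    then have "\<kappa> x = \<kappa> 0" using pointed by (simp add: linear_0 [OF \<kappa>(1)])
    then show "x \<in> {0}" using injD [OF bij_is_inj [OF \<kappa>(2)]] by blast
  qed
  ultimately show "entanglement_breaking lorentz_cone C P"
  proof (cases rule: lorentz_tensor_alternative [where p = p])
    case (decomposed k y x)
    have "P v = (\<Sum>i=1..k. (y i \<bullet> v) *\<^sub>R \<kappa> (x i))" for v
    proof -
      have "\<iota> (P v) = contract v p"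
        using linear_eq_contract [OF linear_compose [OF P \<iota>(1)], of v] by (simp add: p_def)
      then have "P v = \<kappa> (contract v p)" using \<iota>(2) by metis
      also have "\<dots> = (\<Sum>i=1..k. (y i \<bullet> v) *\<^sub>R \<kappa> (x i))"
        by (simp add: decomposed(2) linear_sum [OF linear_contract_right] contract_simple_tensor
            linear_sum [OF \<kappa>(1)] linear_scale [OF \<kappa>(1)])
      finally show ?thesis .
    qed
    then show ?thesis
      unfolding entanglement_breaking_def using decomposed(1)
      by (intro exI [of _ k] exI [of _ "\<lambda>i. \<kappa> (x i)"] exI [of _ "\<lambda>i v. y i \<bullet> v"])
         (auto simp: D_def dual_lorentz_cone)
  next
    case (separated q)
    have "entanglement_annihilating lorentz_cone lorentz_cone ((cocontract q \<circ> \<iota>) \<circ> P)"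
    proof (rule entanglement_annihilating_comp_left [OF ann])
      show "linear (cocontract q \<circ> \<iota>)"
        by (rule linear_compose [OF \<iota>(1) linear_cocontract])
      show "(cocontract q \<circ> \<iota>) ` C \<subseteq> lorentz_cone"
        using separated(1) by (auto simp: D_def \<iota>(2))
    qed
    \<comment> \<open>This inner product is the trace of the composite.\<close>
    then have "0 \<le> q \<bullet> p"
      by (drule_tac annihilating_trace_nonneg)
         (simp add: cocontract_def p_def inner_prod_def inner_vec_def)
    with separated(2) show ?thesis by simp
  qed
qed

text \<open>Here \<open>P\<close> is a tensor over the dual of \<open>C\<close>, so \<open>D\<close>
  is that dual in coordinates, and it is pointed because \<open>C\<close> is generating. The
  positive map to compose with is the adjoint of \<open>cocontract q\<close>, from the Lorentz cone
  to the bidual of \<open>C\<close>.\<close>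

lemma resilient_lorentz_right:
  fixes \<kappa> :: "'e::euclidean_space \<Rightarrow> 'b::real_normed_vector" and C :: "'b set"
  assumes \<kappa>: "linear \<kappa>" "bij \<kappa>"
    and C: "convex_cone C" "closed C" and generating: "{x - y | x y. x \<in> C \<and> y \<in> C} = UNIV"
  shows "resilient C (lorentz_cone :: (real \<times> (real ^ 'n::finite)) set)"
  unfolding resilient_def
proof (intro allI impI)
  fix P :: "'b \<Rightarrow> real \<times> (real ^ 'n)" assume ann: "entanglement_annihilating C lorentz_cone P"
  then have P: "linear P" by (simp add: entanglement_annihilating_def)
  define \<iota> where "\<iota> = inv \<kappa>"
  have \<iota>: "linear \<iota>" "\<And>w. \<kappa> (\<iota> w) = w" "\<And>x. \<iota> (\<kappa> x) = x"
    unfolding \<iota>_def using linear_inv_bij [OF \<kappa>] \<kappa>(2)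
    by (simp_all add: bij_is_surj bij_is_inj surj_f_inv_f)
  define D where "D = {f. \<forall>x\<in>C. 0 \<le> f \<bullet> \<iota> x}"
  have "\<exists>p. \<forall>x. P (\<kappa> x) = cocontract p x"
  proof -
    have "linear (\<lambda>x. fst (P (\<kappa> x)))"
      using linear_compose [OF linear_compose [OF \<kappa>(1) P] linear_fst] by (simp add: comp_def)
    moreover have "linear (\<lambda>x. snd (P (\<kappa> x)) $ i)" for i
      using linear_compose [OF linear_compose [OF \<kappa>(1) P] linear_snd_nth] by (simp add: comp_def)
    ultimately have "\<exists>a. (\<lambda>x. fst (P (\<kappa> x))) = (\<lambda>x. a \<bullet> x)"
      and "\<forall>i. \<exists>b. (\<lambda>x. snd (P (\<kappa> x)) $ i) = (\<lambda>x. b \<bullet> x)"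
      by (metis linear_functional_inner)+
    then obtain a b where ab: "\<And>x. fst (P (\<kappa> x)) = a \<bullet> x" "\<And>i x. snd (P (\<kappa> x)) $ i = b i \<bullet> x"
      by metis
    show ?thesis
      by (intro exI [of _ "(a, \<chi> i. b i)"]) (auto simp: cocontract_def prod_eq_iff vec_eq_iff ab)
  qed
  then obtain p where p: "\<And>x. P (\<kappa> x) = cocontract p x" by metis
  have "convex_cone D"
    by (auto simp: D_def convex_cone_iff inner_simps)
  moreover have "closed D"
  proof -
    have "D = (\<Inter>x\<in>C. {f. \<iota> x \<bullet> f \<ge> 0})" by (auto simp: D_def inner_commute)
    then show ?thesis by (auto intro: closed_halfspace_ge)
  qed
  moreover have "D \<inter> uminus ` D \<subseteq> {0}"
  proof
    fix f assume "f \<in> D \<inter> uminus ` D"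
    then have 0: "f \<bullet> \<iota> x = 0" if "x \<in> C" for x
      using that by (fastforce simp: D_def)
    \<comment> \<open>A functional vanishing on \<open>C\<close> vanishes on all differences, in
      particular at the vector that represents it.\<close>
    have "\<kappa> f \<in> {x - y | x y. x \<in> C \<and> y \<in> C}" unfolding generating by simp
    then obtain x y where "\<kappa> f = x - y" "x \<in> C" "y \<in> C" by auto
    then have "f = \<iota> x - \<iota> y" using \<iota> by (metis linear_diff)
    then have "f \<bullet> f = f \<bullet> (\<iota> x - \<iota> y)" by simp
    also have "\<dots> = 0" using 0 \<open>x \<in> C\<close> \<open>y \<in> C\<close> by (simp add: inner_diff_right)
    finally show "f \<in> {0}" by simp
  qed
  ultimately show "entanglement_breaking C lorentz_cone P"
  proof (cases rule: lorentz_tensor_alternative [where p = p])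
    case (decomposed k y x)
    have "P w = (\<Sum>i=1..k. (x i \<bullet> \<iota> w) *\<^sub>R y i)" for w
    proof -
      have "P w = cocontract p (\<iota> w)" using p [of "\<iota> w"] by (simp add: \<iota>(2))
      also have "\<dots> = (\<Sum>i=1..k. (x i \<bullet> \<iota> w) *\<^sub>R y i)"
        by (simp add: decomposed(2) cocontract_def simple_tensor_def prod_eq_iff fst_sum snd_sum
            vec_eq_iff inner_sum_left mult.commute)
      finally show ?thesis .
    qed
    moreover have "(\<lambda>w. x i \<bullet> \<iota> w) \<in> dual_cone C" if "i \<in> {1..k}" for i
    proof -
      have "linear (\<lambda>w. x i \<bullet> \<iota> w)"
        using linear_compose [OF \<iota>(1) bounded_linear.linear [OF bounded_linear_inner_right]]
        by (simp add: comp_def)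
      with decomposed(1) [OF that] show ?thesis by (auto simp: dual_cone_def D_def)
    qed
    ultimately show ?thesis
      unfolding entanglement_breaking_def using decomposed(1)
      by (intro exI [of _ k] exI [of _ y] exI [of _ "\<lambda>i w. x i \<bullet> \<iota> w"]) auto
  next
    case (separated q)
    have "entanglement_annihilating lorentz_cone lorentz_cone (P \<circ> (\<lambda>v. \<kappa> (contract v q)))"
    proof (rule entanglement_annihilating_comp_right [OF ann])
      show "linear (\<lambda>v. \<kappa> (contract v q))"
        using linear_compose [OF linear_contract_left \<kappa>(1)] by (simp add: comp_def)
      show "(\<lambda>v. \<kappa> (contract v q)) ` lorentz_cone \<subseteq> C"
      proof clarify
        fix v :: "real \<times> (real ^ 'n)" assume v: "v \<in> lorentz_cone"
        have cone: "convex_cone (\<kappa> -` C)"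
          using C(1) by (auto simp: convex_cone_iff linear_0 [OF \<kappa>(1)] linear_add [OF \<kappa>(1)] linear_scale [OF \<kappa>(1)])
        have closed: "closed (\<kappa> -` C)"
          using C(2) linear_continuous_on [of \<kappa> UNIV] \<kappa>(1)
          by (intro closed_vimage) (auto simp: linear_conv_bounded_linear)
        show "\<kappa> (contract v q) \<in> C"
        \<comment> \<open>The bidual argument: a separating \<open>f\<close> would lie in
          \<open>D\<close>, where \<open>cocontract q\<close> is positive.\<close>
        proof (rule ccontr)
          assume "\<kappa> (contract v q) \<notin> C"
          then have "contract v q \<notin> \<kappa> -` C" by simp
          then obtain f where f: "f \<bullet> contract v q < 0" "\<And>z. z \<in> \<kappa> -` C \<Longrightarrow> 0 \<le> f \<bullet> z"
            using closed_convex_cone_separation [OF cone closed] by metis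
          then have "f \<in> D" by (simp add: D_def \<iota>(2))
          then have "0 \<le> v \<bullet> cocontract q f"
            using separated(1) v lorentz_cone_self_dual by blast
          with f(1) show False by (simp add: inner_contract [symmetric] inner_commute)
        qed
      qed
    qed
    then have "0 \<le> p \<bullet> q"
      by (drule_tac annihilating_trace_nonneg)
         (simp add: p cocontract_def inner_prod_def inner_vec_def)
    with separated(2) show ?thesis by (simp add: inner_commute)
  qed
qed

section \<open>Coordinates in a finite-dimensional normed space\<close>

text \<open>A choice made once for each type, because the index type below cannot depend on a basis
  obtained inside a proof.\<close>

definition finite_basis :: "'b::real_vector set" where
  "finite_basis = (SOME B. finite B \<and> independent B \<and> span B = UNIV)"

text \<open>The index type of a basis of \<open>'b\<close>, with a dummy element if \<open>'b\<close> is trivial or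
  infinite-dimensional. It makes the coordinate space of \<open>'b\<close> a Euclidean space type.\<close>

typedef (overloaded) 'b basis_index =
  "if finite (finite_basis :: 'b::real_vector set) \<and> finite_basis \<noteq> ({} :: 'b set)
   then finite_basis else {0 :: 'b}"
  by (auto simp: ex_in_conv)

instance basis_index :: (real_vector) finite
proof
  have "finite (Rep_basis_index ` (UNIV :: 'a basis_index set))"
    unfolding type_definition.Rep_range [OF type_definition_basis_index] by simp
  then show "finite (UNIV :: 'a basis_index set)"
    by (rule finite_imageD) (simp add: Rep_basis_index_inject inj_on_def)
qed

text \<open>The trivial space is excluded because an index type is never empty, so every coordinate
  space has dimension at least 1.\<close>

lemma finite_dimensional_coordinates:
  assumes "\<exists>B::'b::real_vector set. finite B \<and> span B = UNIV" and "(UNIV :: 'b set) \<noteq> {0}"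
  obtains \<kappa> :: "real ^ 'b::real_vector basis_index \<Rightarrow> 'b" where "linear \<kappa>" "bij \<kappa>"
proof -
  let ?B = "finite_basis :: 'b set"
  obtain B0 :: "'b set" where B0: "finite B0" "span B0 = UNIV" using assms(1) by auto
  obtain B where "B \<subseteq> B0" "independent B" "span B = span B0"
    using maximal_independent_subset [of B0] by (metis span_eq span_mono span_superset subset_antisym span_minimal subspace_span)
  with B0 have "finite B \<and> independent B \<and> span B = UNIV" by (auto intro: finite_subset)
  then have B: "finite ?B" "independent ?B" "span ?B = UNIV"
    unfolding finite_basis_def by (metis (mono_tags, lifting) someI)+
  have "?B \<noteq> {}" using B(3) assms(2) by auto
  then have range: "range Rep_basis_index = ?B"
    unfolding type_definition.Rep_range [OF type_definition_basis_index] using B(1) by simp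
  have inj: "inj Rep_basis_index" by (simp add: Rep_basis_index_inject inj_on_def)
  define \<kappa> where "\<kappa> = (\<lambda>x :: real ^ 'b basis_index. \<Sum>i\<in>UNIV. x $ i *\<^sub>R Rep_basis_index i)"
  have \<kappa>: "\<kappa> x = (\<Sum>b\<in>?B. x $ inv Rep_basis_index b *\<^sub>R b)" for x
    unfolding range [symmetric] by (simp add: \<kappa>_def sum.reindex inj)
  show thesis
  proof
    show lin: "linear \<kappa>"
      by (rule linearI) (simp_all add: \<kappa>_def scaleR_add_left sum.distrib scaleR_sum_right)
    have "inj \<kappa>"
      unfolding linear_injective_0 [OF lin]
    proof (intro allI impI)
      fix x assume "\<kappa> x = 0"
      then have "x $ inv Rep_basis_index b = 0" if "b \<in> ?B" for b
        using independentD [OF B(2,1) subset_refl _ that] by (simp add: \<kappa>)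
      then have "x $ i = 0" for i
        using range inj by (metis inv_f_f rangeI)
      then show "x = 0" by (simp add: vec_eq_iff)
    qed
    moreover have "surj \<kappa>"
    unfolding surj_def
    proof
      fix v :: 'b
      have "v \<in> range (\<lambda>u. \<Sum>b\<in>?B. u b *\<^sub>R b)"
        using B(3) span_finite [OF B(1)] by auto
      then obtain u where "v = (\<Sum>b\<in>?B. u b *\<^sub>R b)" by auto
      also have "\<dots> = \<kappa> (\<chi> i. u (Rep_basis_index i))"
        unfolding range [symmetric] by (simp add: \<kappa>_def sum.reindex inj)
      finally show "\<exists>x. v = \<kappa> x" by blast
    qed
    ultimately show "bij \<kappa>" by (simp add: bij_def)
  qed
qed

theorem theorem1p8:
  fixes C :: "'b::real_normed_vector set"
  assumes "\<exists>B::'b set. finite B \<and> span B = UNIV"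
    and "proper_cone C"
  shows "resilient (lorentz_cone :: (real \<times> (real ^ 'n::finite)) set) C
    \<and> resilient C (lorentz_cone :: (real \<times> (real ^ 'n)) set)
    \<and> resilient (lorentz_cone :: (real \<times> (real ^ 'n)) set) (lorentz_cone :: (real \<times> (real ^ 'n)) set)"
proof (intro conjI)
  have C: "convex_cone C" "closed C" "{x - y | x y. x \<in> C \<and> y \<in> C} = UNIV" "C \<inter> uminus ` C = {0}"
    using assms(2) by (simp_all add: proper_cone_def)
  have "resilient (lorentz_cone :: (real \<times> (real ^ 'n)) set) C
    \<and> resilient C (lorentz_cone :: (real \<times> (real ^ 'n)) set)"
  proof (cases "(UNIV :: 'b set) = {0}")
    case True
    \<comment> \<open>Without coordinates, but every linear map from or to the trivial space is
      zero, the empty sum \<open>k = 0\<close>.\<close>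
    then have zero: "w = 0" for w :: 'b by auto
    have "entanglement_breaking lorentz_cone C P" for P :: "real \<times> (real ^ 'n) \<Rightarrow> 'b"
      unfolding entanglement_breaking_def using zero by (intro exI [of _ 0]) auto
    moreover have "entanglement_breaking C lorentz_cone P"
      if "entanglement_annihilating C lorentz_cone P" for P :: "'b \<Rightarrow> real \<times> (real ^ 'n)"
    proof -
      have "linear P" using that by (simp add: entanglement_annihilating_def)
      then have "P = (\<lambda>w. 0)" using zero by (metis linear_0)
      then show ?thesis
        unfolding entanglement_breaking_def by (intro exI [of _ 0]) auto
    qed
    ultimately show ?thesis by (simp add: resilient_def)
  next
    case False
    then obtain \<kappa> :: "real ^ 'b basis_index \<Rightarrow> 'b" where "linear \<kappa>" "bij \<kappa>"
      using finite_dimensional_coordinates [OF assms(1)] by metis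
    with C show ?thesis
      by (blast intro: resilient_lorentz_left resilient_lorentz_right)
  qed
  then show "resilient (lorentz_cone :: (real \<times> (real ^ 'n)) set) C"
    and "resilient C (lorentz_cone :: (real \<times> (real ^ 'n)) set)" by simp_all
  show "resilient (lorentz_cone :: (real \<times> (real ^ 'n)) set) (lorentz_cone :: (real \<times> (real ^ 'n)) set)"
    \<comment> \<open>The Lorentz space is already Euclidean, so the identity serves as coordinate
      map.\<close>
    by (rule resilient_lorentz_left [OF linear_id bij_id lorentz_cone_convex_cone
          lorentz_cone_closed lorentz_cone_pointed])
qed

end
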